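(* Let $W\colon \mathrm{GL}^+(2)\to\mathbb{R}$ be conformally invariant and bounded below, and let $h\colon[1,\infty)\to\mathbb{R}$ denote the function uniquely determined by $$W(F)=h\left(\frac{\lambda_1}{\lambda_2}\right)$$ for all $F\in\mathrm{GL}^+(2)$ with ordered singular values $\lambda_1\ge\lambda_2$. Then $$RW(F)=QW(F)=PW(F)=C_m h\left(\frac{\lambda_1}{\lambda_2}\right)\qquad\text{for all } F\in\mathrm{GL}^+(2) \text{ with singular values } \lambda_1\ge\lambda_2,$$ where $C_m h\colon[1,\infty)\to\mathbb{R}$ denotes the monotone-convex envelope given by $$C_m h(t)=\sup\Big\{p(t)\;\Big|\; p\colon[1,\infty)\to\mathbb{R}\text{ monotone increasing and convex with } p(s)\le h(s)\ \forall s\in[1,\infty)\Big\}.$$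
   Context: $\mathrm{GL}^+(2)$ is the group of real $2\times2$ matrices with positive determinant. "Monotone increasing" means non-decreasing. The conformal special orthogonal group is $\mathrm{CSO}(2)=\{aR\mid a\in(0,\infty),\ R\in\mathrm{SO}(2)\}$. A function $W\colon\mathrm{GL}^+(2)\to\mathbb{R}$ is conformally invariant if $W(AFB)=W(F)$ for all $F\in\mathrm{GL}^+(2)$ and all $A,B\in\mathrm{CSO}(2)$. Every such $W$ can be written uniquely as $W(F)=h(\lambda_1/\lambda_2)$ with $h\colon[1,\infty)\to\mathbb{R}$, where $\lambda_1\ge\lambda_2>0$ are the singular values of $F$ (eigenvalues of $\sqrt{F^TF}$). Convexity notions for $W\colon\mathrm{GL}^+(2)\to\mathbb{R}$: - $W$ is rank-one convex if $W((1-t)F+t(F+H))\le(1-t)W(F)+tW(F+H)$ for all $F\in\mathrm{GL}^+(2)$, $t\in[0,1]$ and $H\in\mathbb{R}^{2\times2}$ with $\operatorname{rank}(H)=1$ and $\det(F+H)>0$. - $W$ is quasiconvex if $\int_\Omega W(F_0+\nabla\vartheta)\,dx\ge W(F_0)\cdot|\Omega|$ for every $F_0\in\mathrm{GL}^+(2)$, every bounded open set $\Omega\subset\mathbb{R}^2$ and all $\vartheta\in C_0^\infty(\Omega;\mathbb{R}^2)$ such that $\det(F_0+\nabla\vartheta)>0$ on $\Omega$. - $W$ is polyconvex if $W(F)=P(F,\det F)$ for all $F\in\mathrm{GL}^+(2)$ for some convex function $P\colon\mathbb{R}^{2\times2}\times\mathbb{R}\cong\mathbb{R}^5\to\mathbb{R}\cup\{+\infty\}$.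 These notions are understood under the usual technical assumptions, under which polyconvexity implies quasiconvexity and quasiconvexity implies rank-one convexity for functions on $\mathrm{GL}^+(2)$. Envelopes: $RW(F)$, $QW(F)$ and $PW(F)$ denote the supremum of $w(F)$ over all functions $w\colon\mathrm{GL}^+(2)\to\mathbb{R}$ with $w(X)\le W(X)$ for all $X\in\mathrm{GL}^+(2)$ which are, respectively, rank-one convex, quasiconvex and polyconvex. *)

theory Defs
  imports "HOL-Analysis.Analysis"
begin

text \<open>Functions on \<open>GL\<^sup>+(2)\<close> and on \<open>[1,\<infinity>)\<close> are total functions whose values outside the domain
  are never inspected: every condition below is guarded by membership.\<close>

definition GLp :: "(real^2^2) set" where
  "GLp = {F. det F > 0}"

definition CSO2 :: "(real^2^2) set" where
  "CSO2 = {a *\<^sub>R R | a R. a > 0 \<and> rotation_matrix R}"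

definition conformally_invariant :: "(real^2^2 \<Rightarrow> real) \<Rightarrow> bool" where
  "conformally_invariant W \<longleftrightarrow>
     (\<forall>F\<in>GLp. \<forall>A\<in>CSO2. \<forall>B\<in>CSO2. W (A ** F ** B) = W F)"


subsection \<open>Singular values\<close>

definition eigenvalues :: "real^'n^'n \<Rightarrow> real set" where
  "eigenvalues A = {l. \<exists>v. v \<noteq> 0 \<and> A *v v = l *\<^sub>R v}"

definition matrix_sqrt :: "real^'n^'n \<Rightarrow> real^'n^'n" where
  "matrix_sqrt A =
     (THE S. transpose S = S \<and> (\<forall>x. 0 \<le> x \<bullet> (S *v x)) \<and> S ** S = A)"

text \<open>For a symmetric \<open>2 \<times> 2\<close> matrix the set of eigenvalues determines their multiplicities:
  \<open>l1 = l2\<close> below is exactly the case of a double singular value.\<close>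

definition ordered_singular_values :: "real^2^2 \<Rightarrow> real \<Rightarrow> real \<Rightarrow> bool" where
  "ordered_singular_values F l1 l2 \<longleftrightarrow>
     l1 \<ge> l2 \<and> eigenvalues (matrix_sqrt (transpose F ** F)) = {l1, l2}"


subsection \<open>Rank-one convexity\<close>

definition rank_one_convex :: "(real^2^2 \<Rightarrow> real) \<Rightarrow> bool" where
  "rank_one_convex W \<longleftrightarrow>
     (\<forall>F\<in>GLp. \<forall>t\<in>{0..1}. \<forall>H. rank H = 1 \<longrightarrow> F + H \<in> GLp \<longrightarrow>
        W ((1 - t) *\<^sub>R F + t *\<^sub>R (F + H)) \<le> (1 - t) * W F + t * W (F + H))"


subsection \<open>Quasiconvexity\<close>

primrec times_cont_diff ::
    "nat \<Rightarrow> ('a::real_normed_vector \<Rightarrow> 'b::real_normed_vector) \<Rightarrow> bool" where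
  "times_cont_diff 0 f \<longleftrightarrow> continuous_on UNIV f"
| "times_cont_diff (Suc k) f \<longleftrightarrow>
     (\<forall>x. f differentiable (at x)) \<and>
     (\<forall>v. times_cont_diff k (\<lambda>x. frechet_derivative f (at x) v))"

text \<open>An element of \<open>C\<^sub>0\<^sup>\<infinity>(\<Omega>; \<real>\<^sup>2)\<close> is identified with its extension by zero to the plane.\<close>

definition test_function :: "(real^2) set \<Rightarrow> (real^2 \<Rightarrow> real^2) \<Rightarrow> bool" where
  "test_function \<Omega> \<theta> \<longleftrightarrow>
     (\<forall>k. times_cont_diff k \<theta>) \<and>
     compact (closure (support_on UNIV \<theta>)) \<and> closure (support_on UNIV \<theta>) \<subseteq> \<Omega>"

text \<open>Quasiconvexity is understood for Borel measurable functions that are locally bounded, i.e.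
  bounded on compact subsets of \<open>GL\<^sup>+(2)\<close>. The matrices \<open>F0 + \<nabla>\<theta>(x)\<close> stay in such a compact
  subset, so the integrals exist, and polyconvexity implies quasiconvexity, which in turn implies
  rank-one convexity. Without such an assumption a non-integrable integrand would be assigned the
  integral \<open>0\<close>.\<close>

definition quasiconvex :: "(real^2^2 \<Rightarrow> real) \<Rightarrow> bool" where
  "quasiconvex W \<longleftrightarrow>
     W \<in> borel_measurable (restrict_space borel GLp) \<and>
     (\<forall>K. compact K \<longrightarrow> K \<subseteq> GLp \<longrightarrow> bounded (W ` K)) \<and>
     (\<forall>F0\<in>GLp. \<forall>\<Omega> \<theta>. open \<Omega> \<longrightarrow> bounded \<Omega> \<longrightarrow> test_function \<Omega> \<theta> \<longrightarrow>
        (\<forall>x\<in>\<Omega>. F0 + jacobian \<theta> (at x) \<in> GLp) \<longrightarrow>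
        (LINT x:\<Omega>|lborel. W (F0 + jacobian \<theta> (at x))) \<ge> W F0 * measure lborel \<Omega>)"


subsection \<open>Polyconvexity\<close>

text \<open>Convexity of functions with values in \<open>\<real> \<union> {+\<infinity>}\<close>, using \<open>0 * \<infinity> = 0\<close> in \<^typ>\<open>ereal\<close>.\<close>

definition ext_convex :: "('a::real_vector \<Rightarrow> ereal) \<Rightarrow> bool" where
  "ext_convex P \<longleftrightarrow>
     (\<forall>X. P X \<noteq> -\<infinity>) \<and>
     (\<forall>X Y. \<forall>t\<in>{0..1}.
        P ((1 - t) *\<^sub>R X + t *\<^sub>R Y) \<le> ereal (1 - t) * P X + ereal t * P Y)"

definition polyconvex :: "(real^2^2 \<Rightarrow> real) \<Rightarrow> bool" where
  "polyconvex W \<longleftrightarrow>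
     (\<exists>P :: (real^2^2) \<times> real \<Rightarrow> ereal.
        ext_convex P \<and> (\<forall>F\<in>GLp. ereal (W F) = P (F, det F)))"


subsection \<open>Envelopes\<close>

text \<open>The suprema are taken in \<open>\<real>\<close>. At \<open>F \<in> GL\<^sup>+(2)\<close> they are over sets bounded above by \<open>W F\<close>,
  and these are nonempty as soon as \<open>W\<close> is bounded below (constants are admissible); likewise for
  the monotone-convex envelope.\<close>

definition envelope ::
    "((real^2^2 \<Rightarrow> real) \<Rightarrow> bool) \<Rightarrow> (real^2^2 \<Rightarrow> real) \<Rightarrow> real^2^2 \<Rightarrow> real" where
  "envelope C W F = Sup {w F | w. C w \<and> (\<forall>X\<in>GLp. w X \<le> W X)}"

definition RW :: "(real^2^2 \<Rightarrow> real) \<Rightarrow> real^2^2 \<Rightarrow> real" where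
  "RW = envelope rank_one_convex"

definition QW :: "(real^2^2 \<Rightarrow> real) \<Rightarrow> real^2^2 \<Rightarrow> real" where
  "QW = envelope quasiconvex"

definition PW :: "(real^2^2 \<Rightarrow> real) \<Rightarrow> real^2^2 \<Rightarrow> real" where
  "PW = envelope polyconvex"

definition Cm :: "(real \<Rightarrow> real) \<Rightarrow> real \<Rightarrow> real" where
  "Cm h t = Sup {p t | p. mono_on {1..} p \<and> convex_on {1..} p \<and> (\<forall>s\<ge>1. p s \<le> h s)}"

end

theory Submission
  imports Defs
begin

text \<open>
  A real \<open>2 \<times> 2\<close> matrix acts on \<open>\<complex>\<close> as \<open>z \<mapsto> a z + b z\<^sup>*\<close>, where \<open>z\<^sup>*\<close> is the conjugate of \<open>z\<close>, with a
  conformal part \<open>a\<close> and an anticonformal part \<open>b\<close> that depend linearly on the matrix. For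
  \<open>\<bar>b\<bar> < \<bar>a\<bar>\<close>, which is positivity of the determinant \<open>\<bar>a\<bar>\<^sup>2 - \<bar>b\<bar>\<^sup>2\<close>, the singular values are
  \<open>\<bar>a\<bar> + \<bar>b\<bar>\<close> and \<open>\<bar>a\<bar> - \<bar>b\<bar>\<close>. Hence the quotient of the singular values is the distortion
  \<open>K(F) = (\<bar>a\<bar> + \<bar>b\<bar>)\<^sup>2 / det F\<close>, and the hypothesis on \<open>W\<close> reads \<open>W = h \<circ> K\<close>.

  Lower bound. The numerator of \<open>K\<close> is the square of a norm and \<open>(x, y) \<mapsto> x\<^sup>2 / y\<close> is convex for
  \<open>y > 0\<close>. So \<open>K\<close>, and with it \<open>p \<circ> K\<close> for every monotone convex \<open>p\<close>, has at each \<open>F\<^sub>0\<close> a minorant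
  that is affine in \<open>(F, det F)\<close> and touches it at \<open>F\<^sub>0\<close>
  (\<open>has_polyaffine_minorants_distortion\<close>). The supremum of these minorants is the convex
  function that polyconvexity asks for. Since \<open>\<integral>\<nabla>\<theta> = 0\<close> and \<open>\<integral>det \<nabla>\<theta> = 0\<close> for test functions,
  integrating the minorant also gives quasiconvexity (\<open>quasiconvex_if_minorants\<close>). Thus \<open>p \<circ> K\<close> competes in all three
  envelopes as soon as \<open>p \<le> h\<close>.

  Upper bound. Polyconvex and quasiconvex functions are rank-one convex, the former because the
  determinant is affine along rank-one lines, the latter by testing with functions whose gradient
  takes essentially two values differing by a rank-one matrix
  (\<open>rank_one_convex_if_quasiconvex\<close>). So let \<open>w \<le> W\<close> be rank-one convex,
  and let \<open>\<phi>(t)\<close> be the supremum of \<open>w(A diag(t,1) B)\<close> over all \<open>A, B \<in> CSO(2)\<close>, which is at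
  most \<open>h(t)\<close> for \<open>t \<ge> 1\<close> by conformal invariance of \<open>W\<close>. The lines \<open>t \<mapsto> A diag(t,1) B\<close> are
  rank-one, hence \<open>\<phi>\<close> is convex on \<open>(0,\<infinity>)\<close>. As \<open>diag(1/t,1)\<close> arises from \<open>diag(t,1)\<close> by conformal
  factors, \<open>\<phi>(1/t) = \<phi>(t)\<close>, and a convex function with this symmetry is monotone on \<open>[1,\<infinity>)\<close>
  (\<open>conformal_sup_minorant\<close>).
  So \<open>\<phi>\<close> competes in \<open>C\<^sub>m h\<close>, and \<open>w(F) \<le> \<phi>(K(F))\<close> because every \<open>F\<close> is of the form
  \<open>A diag(K(F),1) B\<close> (\<open>conformal_decomposition\<close>).
\<close>


section \<open>Conformal and anticonformal parts\<close>

lemmas mat2 = vec_eq_iff forall_2 sum_2 matrix_matrix_mult_def matrix_vector_mult_def transpose_def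

text \<open>The matrix \<open>F\<close> acts on \<open>\<complex>\<close> as \<open>z \<mapsto> conf_part F * z + anti_part F * cnj z\<close>.\<close>

definition conf_part :: "real^2^2 \<Rightarrow> complex" where
  "conf_part F = Complex ((F$1$1 + F$2$2) / 2) ((F$2$1 - F$1$2) / 2)"

definition anti_part :: "real^2^2 \<Rightarrow> complex" where
  "anti_part F = Complex ((F$1$1 - F$2$2) / 2) ((F$2$1 + F$1$2) / 2)"

lemma linear_conf_part: "linear conf_part"
  by (rule linearI) (auto simp: conf_part_def complex_eq_iff field_simps)

lemma linear_anti_part: "linear anti_part"
  by (rule linearI) (auto simp: anti_part_def complex_eq_iff field_simps)

lemma det_eq_conf_anti: "det F = (cmod (conf_part F))\<^sup>2 - (cmod (anti_part F))\<^sup>2"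
  unfolding cmod_power2 conf_part_def anti_part_def det_2
  by (simp add: power2_eq_square field_simps)

lemma GLp_iff_conf_anti: "F \<in> GLp \<longleftrightarrow> cmod (anti_part F) < cmod (conf_part F)"
  by (auto simp: GLp_def det_eq_conf_anti intro: power_strict_mono dest: power_less_imp_less_base)

text \<open>The quotient of the singular values of a matrix with positive determinant.\<close>

definition distortion :: "real^2^2 \<Rightarrow> real" where
  "distortion F = (cmod (conf_part F) + cmod (anti_part F)) /
                  (cmod (conf_part F) - cmod (anti_part F))"

lemma distortion_ge_1: "F \<in> GLp \<Longrightarrow> 1 \<le> distortion F"
  by (simp add: GLp_iff_conf_anti distortion_def field_simps)

lemma distortion_eq_square_over_det:
  assumes "F \<in> GLp"
  shows "distortion F = (cmod (conf_part F) + cmod (anti_part F))\<^sup>2 / det F"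
  using assms unfolding GLp_iff_conf_anti
  by (simp add: distortion_def det_eq_conf_anti power2_eq_square square_diff_square_factored)

lemma continuous_on_distortion: "continuous_on GLp distortion"
proof -
  have "continuous_on UNIV conf_part" "continuous_on UNIV anti_part"
    by (simp_all add: linear_continuous_on linear_linear linear_conf_part linear_anti_part)
  then have "continuous_on GLp conf_part" "continuous_on GLp anti_part"
    by (auto intro: continuous_on_subset)
  then show ?thesis
    unfolding distortion_def[abs_def]
    by (intro continuous_intros) (auto simp: GLp_iff_conf_anti)
qed

lemma norm_ge_inner_sgn: "norm (z::'a::real_inner) \<ge> sgn w \<bullet> z"
  by (metis norm_cauchy_schwarz norm_sgn norm_zero mult_1 mult_zero_left norm_ge_zero order_trans)

text \<open>With \<open>N F = \<bar>conf_part F\<bar> + \<bar>anti_part F\<bar>\<close> the distortion is \<open>(N F)\<^sup>2 / det F\<close>. The function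
  \<open>(x, y) \<mapsto> x\<^sup>2 / y\<close> lies above its tangent \<open>2 k x - k\<^sup>2 y\<close> with \<open>k = x\<^sub>0 / y\<^sub>0\<close>, and the norm \<open>N\<close> lies above a
  supporting linear functional. As \<open>k \<ge> 0\<close>, the two can be composed.\<close>

lemma distortion_polyaffine_minorant:
  assumes F0: "F0 \<in> GLp"
  obtains l c where "linear l"
    and "\<And>F. F \<in> GLp \<Longrightarrow> distortion F0 + l (F - F0) + c * (det F - det F0) \<le> distortion F"
proof
  define N where "N F = cmod (conf_part F) + cmod (anti_part F)" for F
  define k where "k = N F0 / det F0"
  define m where "m F = sgn (conf_part F0) \<bullet> conf_part F + sgn (anti_part F0) \<bullet> anti_part F" for F
  have "det F0 > 0" using F0 by (simp add: GLp_def)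
  have "N F0 \<ge> 0" by (simp add: N_def)
  then have "k \<ge> 0" using \<open>det F0 > 0\<close> by (simp add: k_def)
  have lin: "linear m"
    unfolding m_def
    by (rule linearI)
      (auto simp: linear_add[OF linear_conf_part] linear_add[OF linear_anti_part]
        linear_scale[OF linear_conf_part] linear_scale[OF linear_anti_part] inner_simps algebra_simps)
  then show "linear (\<lambda>F. 2 * k * m F)"
    by (simp add: linear_iff algebra_simps)
  have m_le: "m F \<le> N F" for F
    unfolding m_def N_def by (intro add_mono norm_ge_inner_sgn)
  have sgn_self: "sgn z \<bullet> z = norm z" for z :: complex
    by (cases "z = 0") (auto simp: sgn_div_norm dot_square_norm power2_eq_square)
  have m_F0: "m F0 = N F0"
    by (simp add: m_def N_def sgn_self)
  fix F assume F: "F \<in> GLp"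
  then have "det F > 0" by (simp add: GLp_def)
  \<comment> \<open>Replace the functional by the norm, then use \<open>(N F - k * det F)\<^sup>2 \<ge> 0\<close>.\<close>
  have "2 * k * m F - k\<^sup>2 * det F \<le> 2 * k * N F - k\<^sup>2 * det F"
    using m_le \<open>k \<ge> 0\<close> by (simp add: mult_left_mono)
  also have "\<dots> \<le> (N F)\<^sup>2 / det F"
  proof -
    have "0 \<le> (N F - k * det F)\<^sup>2 / det F"
      using \<open>det F > 0\<close> by simp
    also have "\<dots> = (N F)\<^sup>2 / det F - 2 * k * N F + k\<^sup>2 * det F"
      using \<open>det F > 0\<close> by (simp add: power2_eq_square field_simps)
    finally show ?thesis by simp
  qed
  also have "\<dots> = distortion F"
    using distortion_eq_square_over_det[OF F] by (simp add: N_def)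
  finally have "2 * k * m F - k\<^sup>2 * det F \<le> distortion F" .
  moreover have "distortion F0 = 2 * k * m F0 - k\<^sup>2 * det F0"
    using distortion_eq_square_over_det[OF F0, folded N_def] \<open>det F0 > 0\<close> m_F0
    by (simp add: k_def power2_eq_square field_simps)
  ultimately show "distortion F0 + 2 * k * m (F - F0) + (- k\<^sup>2) * (det F - det F0) \<le> distortion F"
    by (simp add: linear_diff[OF lin] algebra_simps)
qed

section \<open>Singular values of planar matrices\<close>

lemma eigenvalues_2x2:
  fixes A :: "real^2^2"
  shows "eigenvalues A = {l. l\<^sup>2 - (A$1$1 + A$2$2) * l + det A = 0}"
proof -
  have "(\<exists>v. v \<noteq> 0 \<and> A *v v = l *\<^sub>R v) \<longleftrightarrow> det (A - l *\<^sub>R mat 1) = 0" for l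
  proof -
    have "A *v v = l *\<^sub>R v \<longleftrightarrow> (A - l *\<^sub>R mat 1) *v v = 0" for v
      by (simp add: matrix_vector_mult_diff_rdistrib scaleR_matrix_vector_assoc[symmetric])
    then have "(\<exists>v. v \<noteq> 0 \<and> A *v v = l *\<^sub>R v) \<longleftrightarrow> \<not> inj ((*v) (A - l *\<^sub>R mat 1))"
      by (metis less_rank_noninjective linear_injective_0 matrix_vector_mul_linear)
    also have "\<dots> \<longleftrightarrow> det (A - l *\<^sub>R mat 1) = 0"
    proof -
      have "det (A - l *\<^sub>R mat 1) \<noteq> 0 \<longleftrightarrow> inj ((*v) (A - l *\<^sub>R mat 1))"
        using det_nz_iff_inj[of "(*v) (A - l *\<^sub>R mat 1)"] by simp
      then show ?thesis by blast
    qed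
    finally show ?thesis .
  qed
  moreover have "det (A - l *\<^sub>R mat 1) = l\<^sup>2 - (A$1$1 + A$2$2) * l + det A" for l
    by (simp add: det_2 mat_def power2_eq_square algebra_simps)
  ultimately show ?thesis
    by (simp add: eigenvalues_def)
qed

lemma symmetric_2x2: "transpose T = T \<Longrightarrow> T$2$1 = (T :: real^2^2)$1$2"
  by (simp add: vec_eq_iff transpose_def)

lemma conf_part_square: "4 * (cmod (conf_part F))\<^sup>2 = (F$1$1 + F$2$2)\<^sup>2 + (F$2$1 - F$1$2)\<^sup>2"
  by (simp add: cmod_power2 conf_part_def power_divide)

text \<open>Evaluating the quadratic form of \<open>T\<close> at the rows of its adjugate gives the determinant times a
  diagonal entry. This settles the sign unless both diagonal entries vanish, and then positivity
  at \<open>(1,1)\<close> and \<open>(1,-1)\<close> forces \<open>T = 0\<close>.\<close>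

lemma det_psd_nonneg:
  fixes T :: "real^2^2"
  assumes sym: "transpose T = T" and psd: "\<And>x. 0 \<le> x \<bullet> (T *v x)"
  shows "0 \<le> det T" "0 \<le> T$1$1 + T$2$2"
proof -
  have q: "T$2$1 = T$1$2" using sym by (rule symmetric_2x2)
  have form: "0 \<le> T$1$1 * x * x + 2 * T$1$2 * x * y + T$2$2 * y * y" for x y
    using psd[of "vector [x, y]"] q
    by (simp add: inner_vec_def sum_2 matrix_vector_mult_def algebra_simps)
  have pos: "0 \<le> T$1$1" "0 \<le> T$2$2" using form[of 1 0] form[of 0 1] by simp_all
  then show "0 \<le> T$1$1 + T$2$2" by simp
  have "0 \<le> T$1$1 * det T"
    using form[of "T$1$2" "- T$1$1"] q by (simp add: det_2 algebra_simps)
  moreover have "0 \<le> T$2$2 * det T"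
    using form[of "T$2$2" "- T$1$2"] q by (simp add: det_2 algebra_simps)
  moreover have "0 \<le> det T" if "T$1$1 = 0" "T$2$2 = 0"
    using form[of 1 1] form[of 1 "-1"] that q by (simp add: det_2)
  ultimately show "0 \<le> det T"
    using pos by (metis less_eq_real_def zero_le_mult_iff linorder_not_less)
qed

text \<open>By Cayley-Hamilton a square root \<open>S\<close> of \<open>C = F\<^sup>T F\<close> satisfies \<open>tr S * S = C + det S * I\<close>. If \<open>S\<close> is
  positive semidefinite, then \<open>det S = det F\<close> and \<open>(tr S)\<^sup>2 = tr C + 2 det F\<close>, which is
  \<open>4 \<bar>conf_part F\<bar>\<^sup>2\<close>. So this formula is the only candidate, and it is indeed a root.\<close>

lemma matrix_sqrt_2x2:
  fixes F :: "real^2^2"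
  assumes F: "F \<in> GLp"
  defines "C \<equiv> transpose F ** F"
  shows "matrix_sqrt C = (1 / (2 * cmod (conf_part F))) *\<^sub>R (C + det F *\<^sub>R mat 1)"
proof -
  define \<tau> where "\<tau> = 2 * cmod (conf_part F)"
  have d: "det F > 0" using F by (simp add: GLp_def)
  have "\<tau> > 0" using F unfolding GLp_iff_conf_anti \<tau>_def
    by (smt (verit) norm_ge_zero)
  have C_nth: "C$1$1 = F$1$1 * F$1$1 + F$2$1 * F$2$1" "C$1$2 = F$1$1 * F$1$2 + F$2$1 * F$2$2"
    "C$2$1 = C$1$2" "C$2$2 = F$1$2 * F$1$2 + F$2$2 * F$2$2"
    by (simp_all add: C_def mat2)
  have \<tau>2: "\<tau> * \<tau> = C$1$1 + C$2$2 + 2 * det F"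
  proof -
    have "\<tau> * \<tau> = 4 * (cmod (conf_part F))\<^sup>2" by (simp add: \<tau>_def power2_eq_square)
    also have "\<dots> = C$1$1 + C$2$2 + 2 * det F"
      unfolding conf_part_square C_nth det_2 by (simp add: power2_eq_square algebra_simps)
    finally show ?thesis .
  qed
  have detC: "C$1$1 * C$2$2 - C$1$2 * C$1$2 = det F * det F"
    by (simp add: C_nth det_2 algebra_simps)
  define S where "S = (1 / \<tau>) *\<^sub>R (C + det F *\<^sub>R mat 1)"
  have S_nth: "S$1$1 = (C$1$1 + det F) / \<tau>" "S$1$2 = C$1$2 / \<tau>" "S$2$1 = C$1$2 / \<tau>"
    "S$2$2 = (C$2$2 + det F) / \<tau>"
    by (simp_all add: S_def mat_def C_nth(3))
  have "matrix_sqrt C = S"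
    unfolding matrix_sqrt_def
  proof (rule the_equality)
    have "transpose S = S"
      by (simp add: vec_eq_iff forall_2 transpose_def S_nth)
    moreover have "0 \<le> x \<bullet> (S *v x)" for x
    proof -
      have "x \<bullet> (S *v x) = (1 / \<tau>) * (x \<bullet> (C *v x) + det F * (x \<bullet> x))"
        unfolding S_def
        by (simp add: matrix_vector_mult_add_rdistrib scaleR_matrix_vector_assoc[symmetric] inner_add_right)
      moreover have "x \<bullet> (C *v x) = (F *v x) \<bullet> (F *v x)"
        unfolding C_def by (simp add: matrix_vector_mul_assoc[symmetric] dot_lmul_matrix[symmetric] inner_commute)
      ultimately show ?thesis using \<open>\<tau> > 0\<close> d by simp
    qed
    moreover have "S ** S = C"
    proof -
      have "(C$1$1 + det F) * (C$1$1 + det F) + C$1$2 * C$1$2 = C$1$1 * (\<tau> * \<tau>)"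
        "(C$1$1 + det F) * C$1$2 + C$1$2 * (C$2$2 + det F) = C$1$2 * (\<tau> * \<tau>)"
        "C$1$2 * (C$1$1 + det F) + (C$2$2 + det F) * C$1$2 = C$1$2 * (\<tau> * \<tau>)"
        "C$1$2 * C$1$2 + (C$2$2 + det F) * (C$2$2 + det F) = C$2$2 * (\<tau> * \<tau>)"
        using detC \<tau>2 by algebra+
      then show ?thesis
        using \<open>\<tau> > 0\<close>
        by (simp add: vec_eq_iff forall_2 matrix_matrix_mult_def sum_2 S_nth C_nth(3)
            add_divide_distrib[symmetric])
    qed
    ultimately show "transpose S = S \<and> (\<forall>x. 0 \<le> x \<bullet> (S *v x)) \<and> S ** S = C" by blast
  next
    fix T :: "real^2^2"
    assume T: "transpose T = T \<and> (\<forall>x. 0 \<le> x \<bullet> (T *v x)) \<and> T ** T = C"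
    then have nonneg: "0 \<le> det T" "0 \<le> T$1$1 + T$2$2" using det_psd_nonneg by blast+
    have q: "T$2$1 = T$1$2" using T by (blast intro: symmetric_2x2)
    have "(det T)\<^sup>2 = (det F)\<^sup>2"
      using T det_mul[of T T] det_mul[of "transpose F" F]
      by (simp add: C_def det_transpose power2_eq_square)
    then have detT: "det T = det F" using nonneg(1) d by (simp add: power2_eq_iff_nonneg)
    have TT: "T$1$1 * T$1$1 + T$1$2 * T$1$2 = C$1$1" "T$1$1 * T$1$2 + T$1$2 * T$2$2 = C$1$2"
      "T$1$2 * T$1$2 + T$2$2 * T$2$2 = C$2$2"
      using T q by (auto simp: mat2)
    have detT': "T$1$1 * T$2$2 - T$1$2 * T$1$2 = det F"
      using detT q by (simp add: det_2)
    have "(T$1$1 + T$2$2)\<^sup>2 = \<tau>\<^sup>2"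
      using \<tau>2 TT detT' by (simp add: power2_eq_square algebra_simps)
    then have tr: "T$1$1 + T$2$2 = \<tau>" using nonneg(2) \<open>\<tau> > 0\<close> by (simp add: power2_eq_iff_nonneg)
    have "\<tau> * T$1$1 = C$1$1 + det F" "\<tau> * T$1$2 = C$1$2" "\<tau> * T$2$2 = C$2$2 + det F"
      using TT detT' by (simp_all add: tr[symmetric] algebra_simps)
    then show "T = S"
      using \<open>\<tau> > 0\<close> q by (simp add: vec_eq_iff forall_2 S_nth field_simps)
  qed
  then show ?thesis by (simp add: S_def \<tau>_def)
qed

text \<open>The square root has trace \<open>2 \<bar>conf_part F\<bar>\<close> and determinant \<open>\<bar>conf_part F\<bar>\<^sup>2 - \<bar>anti_part F\<bar>\<^sup>2\<close>, so its
  characteristic polynomial splits explicitly.\<close>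

lemma ordered_singular_values_iff:
  assumes F: "F \<in> GLp"
  shows "ordered_singular_values F l1 l2 \<longleftrightarrow>
    l1 = cmod (conf_part F) + cmod (anti_part F) \<and> l2 = cmod (conf_part F) - cmod (anti_part F)"
proof -
  define \<alpha> \<beta> where "\<alpha> = cmod (conf_part F)" and "\<beta> = cmod (anti_part F)"
  have ab: "\<beta> < \<alpha>" "0 \<le> \<beta>" using F by (simp_all add: \<alpha>_def \<beta>_def GLp_iff_conf_anti)
  define C where "C = transpose F ** F"
  define S where "S = matrix_sqrt C"
  have S: "S = (1 / (2 * \<alpha>)) *\<^sub>R (C + det F *\<^sub>R mat 1)"
    unfolding S_def C_def \<alpha>_def by (rule matrix_sqrt_2x2[OF F])
  have dF: "det F = \<alpha>\<^sup>2 - \<beta>\<^sup>2" unfolding \<alpha>_def \<beta>_def by (rule det_eq_conf_anti)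
  have C_nth: "C$1$1 = F$1$1 * F$1$1 + F$2$1 * F$2$1" "C$1$2 = F$1$1 * F$1$2 + F$2$1 * F$2$2"
    "C$2$1 = C$1$2" "C$2$2 = F$1$2 * F$1$2 + F$2$2 * F$2$2"
    by (simp_all add: C_def mat2)
  have trC: "C$1$1 + C$2$2 + 2 * det F = 4 * \<alpha>\<^sup>2"
    unfolding \<alpha>_def conf_part_square C_nth det_2 by (simp add: power2_eq_square algebra_simps)
  have detC: "C$1$1 * C$2$2 - C$1$2 * C$1$2 = det F * det F"
    by (simp add: C_nth det_2 algebra_simps)
  have "S$1$1 + S$2$2 = (C$1$1 + C$2$2 + 2 * det F) / (2 * \<alpha>)"
    by (simp add: S mat_def add_divide_distrib)
  then have tr: "S$1$1 + S$2$2 = 2 * \<alpha>"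
    using trC ab by (simp add: power2_eq_square)
  have "det S = ((C$1$1 + det F) * (C$2$2 + det F) - C$1$2 * C$1$2) / (4 * \<alpha>\<^sup>2)"
    by (simp add: S det_2[of "_ *\<^sub>R _"] mat_def C_nth(3) power2_eq_square diff_divide_distrib)
  also have "(C$1$1 + det F) * (C$2$2 + det F) - C$1$2 * C$1$2 = det F * (4 * \<alpha>\<^sup>2)"
    using detC by (simp add: trC[symmetric] algebra_simps)
  finally have "det S = det F" using ab by simp
  then have "eigenvalues S = {l. l\<^sup>2 - 2 * \<alpha> * l + (\<alpha>\<^sup>2 - \<beta>\<^sup>2) = 0}"
    by (simp add: eigenvalues_2x2 tr dF)
  also have "\<dots> = {l. (l - (\<alpha> + \<beta>)) * (l - (\<alpha> - \<beta>)) = 0}"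
    by (simp add: power2_eq_square algebra_simps)
  also have "\<dots> = {\<alpha> + \<beta>, \<alpha> - \<beta>}" by auto
  finally have "eigenvalues (matrix_sqrt (transpose F ** F)) = {\<alpha> + \<beta>, \<alpha> - \<beta>}"
    by (simp add: S_def C_def)
  then show ?thesis
    unfolding ordered_singular_values_def \<alpha>_def[symmetric] \<beta>_def[symmetric]
    using ab by (auto simp: doubleton_eq_iff)
qed

lemma ordered_singular_values_distortion:
  assumes "F \<in> GLp" "ordered_singular_values F l1 l2"
  shows "l1 / l2 = distortion F"
  using assms by (simp add: ordered_singular_values_iff distortion_def)


section \<open>Polyaffine minorants and polyconvexity\<close>

lemma convex_on_subgradient:
  fixes q :: "real \<Rightarrow> real"
  assumes "convex_on UNIV q"
  obtains s where "\<And>y. q x + s * (y - x) \<le> q y"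
proof -
  have "q x + Inf ((\<lambda>t. (q x - q t) / (x - t)) ` ({x<..} \<inter> UNIV)) * (y - x) \<le> q y" for y
    using convex_le_Inf_differential[OF assms, of x y] by simp
  then show ?thesis by (rule that)
qed

text \<open>At each point of \<open>GL\<^sup>+(2)\<close> some function that is affine in \<open>(F, det F)\<close> touches \<open>w\<close> from below.
  This is a common sufficient condition for polyconvexity and quasiconvexity.\<close>

definition has_polyaffine_minorants :: "(real^2^2 \<Rightarrow> real) \<Rightarrow> bool" where
  "has_polyaffine_minorants w \<longleftrightarrow>
     (\<forall>F0\<in>GLp. \<exists>l c. linear l \<and> (\<forall>F\<in>GLp. w F0 + l (F - F0) + c * (det F - det F0) \<le> w F))"

text \<open>Continuing a monotone convex function to the left by its value at the end point keeps it convex.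
  On the whole line, convexity provides continuity and subgradients at the end point as well.\<close>

lemma convex_on_extend_const:
  fixes p :: "real \<Rightarrow> real"
  assumes mono: "mono_on {a..} p" and conv: "convex_on {a..} p"
  shows "convex_on UNIV (\<lambda>t. p (max a t))"
proof (rule convex_onI)
  fix t x y :: real
  assume t: "0 < t" "t < 1"
  have "(1 - t) * a + t * a \<le> (1 - t) * max a x + t * max a y"
    "(1 - t) * x + t * y \<le> (1 - t) * max a x + t * max a y"
    using t by (intro add_mono mult_left_mono; simp)+
  then have "p (max a ((1 - t) * x + t * y)) \<le> p ((1 - t) * max a x + t * max a y)"
    by (intro mono_onD[OF mono]) (auto simp: left_diff_distrib)
  also have "\<dots> \<le> (1 - t) * p (max a x) + t * p (max a y)"
    using convex_onD[OF conv, of t "max a x" "max a y"] t by simp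
  finally show "p (max a ((1 - t) *\<^sub>R x + t *\<^sub>R y)) \<le> (1 - t) * p (max a x) + t * p (max a y)"
    by simp
qed simp

text \<open>Compose a subgradient of \<open>p\<close> with the minorant of the distortion. Its slope is nonnegative
  because \<open>p\<close> is monotone, so the composition preserves the inequality.\<close>

lemma has_polyaffine_minorants_distortion:
  assumes mono: "mono_on {1..} p" and conv: "convex_on {1..} p"
  shows "has_polyaffine_minorants (\<lambda>F. p (distortion F))"
  unfolding has_polyaffine_minorants_def
proof
  fix F0 assume F0: "F0 \<in> GLp"
  obtain s where s: "\<And>y. p (max 1 (distortion F0)) + s * (y - distortion F0) \<le> p (max 1 y)"
    using convex_on_subgradient[OF convex_on_extend_const[OF mono conv]] by blast
  \<comment> \<open>The argument \<open>distortion F0 - 1\<close> may lie to the left of \<open>1\<close>, where the extension is constant.\<close>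
  have "s \<ge> 0"
  proof -
    have "p (max 1 (distortion F0 - 1)) \<le> p (max 1 (distortion F0))"
      by (intro mono_onD[OF mono]) auto
    with s[of "distortion F0 - 1"] show ?thesis by simp
  qed
  obtain l c where lc: "linear l"
    "\<And>F. F \<in> GLp \<Longrightarrow> distortion F0 + l (F - F0) + c * (det F - det F0) \<le> distortion F"
    using distortion_polyaffine_minorant[OF F0] by blast
  have "p (distortion F0) + s * l (F - F0) + (s * c) * (det F - det F0) \<le> p (distortion F)"
    if F: "F \<in> GLp" for F
  proof -
    have "s * (l (F - F0) + c * (det F - det F0)) \<le> s * (distortion F - distortion F0)"
      using lc(2)[OF F] \<open>s \<ge> 0\<close> by (intro mult_left_mono) auto
    with s[of "distortion F"] distortion_ge_1[OF F] distortion_ge_1[OF F0] show ?thesis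
      by (simp add: algebra_simps)
  qed
  moreover have "linear (\<lambda>F. s * l F)"
    using lc(1) by (simp add: linear_iff algebra_simps)
  ultimately show "\<exists>l c. linear l \<and>
      (\<forall>F\<in>GLp. p (distortion F0) + l (F - F0) + c * (det F - det F0) \<le> p (distortion F))"
    by blast
qed

lemma continuous_on_monotone_convex_distortion:
  assumes mono: "mono_on {1..} p" and conv: "convex_on {1..} p"
  shows "continuous_on GLp (\<lambda>F. p (distortion F))"
proof -
  have "continuous_on UNIV (\<lambda>t. p (max 1 t))"
    using convex_on_continuous[OF open_UNIV convex_on_extend_const[OF mono conv]] .
  then have "continuous_on GLp (\<lambda>F. p (max 1 (distortion F)))"
    by (rule continuous_on_compose2[OF _ continuous_on_distortion]) auto
  then show ?thesis
    by (rule continuous_on_eq) (simp add: distortion_ge_1)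
qed

text \<open>The supremum of all the minorants, regarded as affine functions of a matrix and an independent
  real variable, is convex, and on the graph of the determinant it equals \<open>w\<close>.\<close>

lemma polyconvex_if_minorants:
  assumes "has_polyaffine_minorants w"
  shows "polyconvex w"
proof -
  obtain l c where lin: "\<And>F0. F0 \<in> GLp \<Longrightarrow> linear (l F0)"
    and minor: "\<And>F0 F. F0 \<in> GLp \<Longrightarrow> F \<in> GLp \<Longrightarrow>
      w F0 + l F0 (F - F0) + c F0 * (det F - det F0) \<le> w F"
    using assms unfolding has_polyaffine_minorants_def by metis
  define a where "a F0 X = w F0 + l F0 (fst X - F0) + c F0 * (snd X - det F0)"
    for F0 and X :: "(real^2^2) \<times> real"
  define P where "P X = (SUP F0\<in>GLp. ereal (a F0 X))" for X
  have a_le: "ereal (a F0 X) \<le> P X" if "F0 \<in> GLp" for F0 X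
    unfolding P_def using that by (intro SUP_upper)
  have "mat 1 \<in> GLp" by (simp add: GLp_def)
  have affine: "a F0 ((1 - t) *\<^sub>R X + t *\<^sub>R Y) = (1 - t) * a F0 X + t * a F0 Y"
    if "F0 \<in> GLp" for F0 X Y t
  proof -
    have "l F0 (fst ((1 - t) *\<^sub>R X + t *\<^sub>R Y) - F0)
        = (1 - t) * l F0 (fst X - F0) + t * l F0 (fst Y - F0)"
      using lin[OF that] by (simp add: linear_diff linear_add linear_scale algebra_simps)
    then show ?thesis
      unfolding a_def by (simp add: algebra_simps)
  qed
  have "ext_convex P"
    unfolding ext_convex_def
  proof (intro conjI allI ballI)
    fix X show "P X \<noteq> -\<infinity>"
      using a_le[OF \<open>mat 1 \<in> GLp\<close>, of X] by auto
  next
    fix X Y and t :: real assume t: "t \<in> {0..1}"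
    show "P ((1 - t) *\<^sub>R X + t *\<^sub>R Y) \<le> ereal (1 - t) * P X + ereal t * P Y"
      unfolding P_def[of "(1 - t) *\<^sub>R X + t *\<^sub>R Y"]
    proof (rule SUP_least)
      fix F0 :: "real^2^2" assume F0: "F0 \<in> GLp"
      have "ereal (a F0 ((1 - t) *\<^sub>R X + t *\<^sub>R Y))
          = ereal (1 - t) * ereal (a F0 X) + ereal t * ereal (a F0 Y)"
        using affine[OF F0] by simp
      also have "\<dots> \<le> ereal (1 - t) * P X + ereal t * P Y"
        using t a_le[OF F0] by (intro add_mono ereal_mult_left_mono) auto
      finally show "ereal (a F0 ((1 - t) *\<^sub>R X + t *\<^sub>R Y)) \<le> ereal (1 - t) * P X + ereal t * P Y" .
    qed
  qed
  moreover have "ereal (w F) = P (F, det F)" if F: "F \<in> GLp" for F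
  proof (rule antisym)
    show "ereal (w F) \<le> P (F, det F)"
      using a_le[OF F, of "(F, det F)"] by (simp add: a_def linear_0[OF lin[OF F]])
    show "P (F, det F) \<le> ereal (w F)"
      unfolding P_def using minor[OF _ F] by (intro SUP_least) (simp add: a_def)
  qed
  ultimately show ?thesis
    unfolding polyconvex_def by blast
qed

lemma rank_one_iff_2x2: "rank (H :: real^2^2) = 1 \<longleftrightarrow> H \<noteq> 0 \<and> det H = 0"
proof -
  have "rank H \<le> 2" using rank_bound[of H] by simp
  moreover have "rank H = 2 \<longleftrightarrow> det H \<noteq> 0"
    using full_rank_injective[of H] using det_nz_iff_inj[of "(*v) H"] by simp
  ultimately show ?thesis
    using rank_eq_0[of H] by (metis One_nat_def le_SucE le_zero_eq nat.distinct(1) numeral_2_eq_2 old.nat.inject)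
qed

text \<open>The determinant is affine along rank-one lines.\<close>

lemma det_add_singular:
  fixes F H :: "real^2^2"
  assumes "det H = 0"
  shows "det (F + s *\<^sub>R H) = (1 - s) * det F + s * det (F + H)"
  using assms by (simp add: det_2 algebra_simps)

text \<open>Along a rank-one line the pair \<open>(F, det F)\<close> moves on a line, on which \<open>P\<close> is convex.\<close>

lemma rank_one_convex_if_polyconvex:
  assumes "polyconvex w" shows "rank_one_convex w"
  unfolding rank_one_convex_def
proof (intro ballI allI impI)
  fix F H :: "real^2^2" and t :: real
  assume F: "F \<in> GLp" and t: "t \<in> {0..1}" and "rank H = 1" and FH: "F + H \<in> GLp"
  obtain P where P: "ext_convex P" "\<And>F. F \<in> GLp \<Longrightarrow> ereal (w F) = P (F, det F)"
    using assms unfolding polyconvex_def by blast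
  define G where "G = (1 - t) *\<^sub>R F + t *\<^sub>R (F + H)"
  have G: "G = F + t *\<^sub>R H" by (simp add: G_def algebra_simps)
  have det: "det G = (1 - t) * det F + t * det (F + H)"
    unfolding G using \<open>rank H = 1\<close> rank_one_iff_2x2 by (intro det_add_singular) blast
  have "0 < det G"
    unfolding det using t F FH
    by (cases "t = 0") (auto simp: GLp_def intro: add_nonneg_pos)
  then have "ereal (w G) = P ((1 - t) *\<^sub>R (F, det F) + t *\<^sub>R (F + H, det (F + H)))"
    using P(2)[of G] det by (simp add: GLp_def G_def)
  also have "\<dots> \<le> ereal (1 - t) * P (F, det F) + ereal t * P (F + H, det (F + H))"
    using P(1) t unfolding ext_convex_def by blast
  also have "\<dots> = ereal ((1 - t) * w F + t * w (F + H))"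
    by (simp flip: P(2)[OF F] P(2)[OF FH])
  finally show "w ((1 - t) *\<^sub>R F + t *\<^sub>R (F + H)) \<le> (1 - t) * w F + t * w (F + H)"
    by (simp add: G_def)
qed


section \<open>Null Lagrangians and quasiconvexity\<close>

lemma lborel_integral_translate:
  fixes f :: "'a::euclidean_space \<Rightarrow> real"
  assumes "f \<in> borel_measurable borel"
  shows "(LINT x|lborel. f (x + a)) = (LINT x|lborel. f x)"
proof -
  have "distr lborel borel (\<lambda>x. a + x) = (lborel :: 'a measure)"
    using lborel_affine[of 1 a] by (simp add: density_1)
  then have "(LINT x|lborel. f x) = (LINT x|distr lborel borel (\<lambda>x. a + x). f x)"
    by simp
  also have "\<dots> = (LINT x|lborel. f (a + x))"
    using assms by (intro integral_distr) auto
  finally show ?thesis by (simp add: add.commute)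
qed

lemma integrable_continuous_compact_support:
  fixes f :: "'a::euclidean_space \<Rightarrow> 'b::euclidean_space"
  assumes "continuous_on UNIV f" "compact K" "\<And>x. x \<notin> K \<Longrightarrow> f x = 0"
  shows "integrable lborel f"
proof -
  have "integrable lborel (\<lambda>x. indicator K x *\<^sub>R f x)"
    using assms(1,2) by (intro borel_integrable_compact) (auto intro: continuous_on_subset)
  also have "(\<lambda>x. indicator K x *\<^sub>R f x) = f"
    using assms(3) by (auto simp: indicator_def)
  finally show ?thesis .
qed

text \<open>The second argument supplies the derivative, so that directional derivatives can be named without
  choosing them anew in each statement.\<close>

definition C1_compact_support ::
    "('a::euclidean_space \<Rightarrow> real) \<Rightarrow> ('a \<Rightarrow> 'a \<Rightarrow> real) \<Rightarrow> bool" where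
  "C1_compact_support u u' \<longleftrightarrow>
     (\<forall>x. (u has_derivative u' x) (at x)) \<and> (\<forall>v. continuous_on UNIV (\<lambda>x. u' x v)) \<and>
     (\<exists>K. compact K \<and> (\<forall>x. x \<notin> K \<longrightarrow> u x = 0))"

lemma C1_compact_support_continuous:
  "C1_compact_support u u' \<Longrightarrow> continuous_on S u"
  unfolding C1_compact_support_def
  by (meson has_derivative_at_withinI has_derivative_continuous_on)

lemma has_derivative_zero_outside_closed:
  assumes "(u has_derivative D) (at x)" "closed K" "\<And>y. y \<notin> K \<Longrightarrow> u y = 0" "x \<notin> K"
  shows "D = (\<lambda>v. 0)"
proof -
  have "(u has_derivative (\<lambda>v. 0)) (at x)"
  proof (rule has_derivative_transform_within_open[of "\<lambda>_. 0"])
    show "open (- K)" using assms(2) by (simp add: open_Compl)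
  qed (use assms in auto)
  with assms(1) show ?thesis by (rule has_derivative_unique)
qed

lemma C1_compact_supportE:
  assumes "C1_compact_support u u'"
  obtains K where "compact K" "\<And>x. x \<notin> K \<Longrightarrow> u x = 0" "\<And>x v. x \<notin> K \<Longrightarrow> u' x v = 0"
proof -
  obtain K where K: "compact K" "\<And>x. x \<notin> K \<Longrightarrow> u x = 0"
    using assms unfolding C1_compact_support_def by blast
  have "u' x v = 0" if "x \<notin> K" for x v
    using has_derivative_zero_outside_closed[of u "u' x" x K] K that compact_imp_closed assms
    unfolding C1_compact_support_def by metis
  with K show ?thesis by (rule that)
qed

lemma C1_compact_support_mult:
  assumes u: "C1_compact_support u u'" and v: "C1_compact_support v v'"
  shows "C1_compact_support (\<lambda>x. u x * v x) (\<lambda>x d. u x * v' x d + u' x d * v x)"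
proof -
  note cont = C1_compact_support_continuous[OF u] C1_compact_support_continuous[OF v]
  show ?thesis
    using u v cont unfolding C1_compact_support_def
    by (auto intro!: has_derivative_mult continuous_intros)
qed

lemma C1_compact_support_diff_quotient:
  assumes u: "C1_compact_support u u'"
  shows "C1_compact_support (\<lambda>x. (u (x + a) - u x) / h) (\<lambda>x d. (u' (x + a) d - u' x d) / h)"
  unfolding C1_compact_support_def
proof (intro conjI allI)
  have du: "(u has_derivative u' x) (at x)" for x
    using u by (simp add: C1_compact_support_def)
  have "((\<lambda>x. u (x + a)) has_derivative u' (x + a)) (at x)" for x
    by (rule has_derivative_compose[of "\<lambda>x. x + a" "\<lambda>d. d" x UNIV u "u' (x + a)", simplified])
      (auto intro!: derivative_eq_intros du)
  then show "((\<lambda>x. (u (x + a) - u x) / h) has_derivative (\<lambda>d. (u' (x + a) d - u' x d) / h)) (at x)" for x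
    using du by (auto intro!: derivative_eq_intros simp: divide_inverse)
  have c: "continuous_on UNIV (\<lambda>x. u' x d)" for d
    using u by (simp add: C1_compact_support_def)
  show "continuous_on UNIV (\<lambda>x. (u' (x + a) d - u' x d) / h)" for d
    unfolding divide_inverse
    by (intro continuous_intros c continuous_on_compose2[OF c, of UNIV "\<lambda>x. x + a"]) auto
  obtain K where K: "compact K" "\<And>x. x \<notin> K \<Longrightarrow> u x = 0"
    using u unfolding C1_compact_support_def by blast
  have "x + a \<notin> K" if "x \<notin> (\<lambda>y. y - a) ` K" for x
    using that by (metis add_diff_cancel_right' image_eqI)
  moreover have "compact ((\<lambda>y. y - a) ` K \<union> K)"
    using K(1) by (intro compact_Un compact_continuous_image continuous_intros)
  ultimately show "\<exists>K. compact K \<and> (\<forall>x. x \<notin> K \<longrightarrow> (u (x + a) - u x) / h = 0)"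
    using K(2) by (intro exI[of _ "(\<lambda>y. y - a) ` K \<union> K"]) auto
qed

text \<open>Dominated convergence: by the mean value theorem all difference quotients with step at most \<open>1\<close> are
  bounded by the maximum of the directional derivative, and they live on a common compact set.\<close>

lemma integral_diff_quotient_tendsto:
  assumes u: "C1_compact_support u u'" and g: "continuous_on UNIV g"
  shows "(\<lambda>n. LINT x|lborel. (u (x + inverse (real (Suc n)) *\<^sub>R v) - u x) / inverse (real (Suc n)) * g x)
           \<longlonglongrightarrow> (LINT x|lborel. u' x v * g x)"
proof -
  have du: "(u has_derivative u' x) (at x)" for x
    using u by (simp add: C1_compact_support_def)
  have cu': "continuous_on UNIV (\<lambda>x. u' x v)"
    using u by (simp add: C1_compact_support_def)
  obtain K where K: "compact K" "\<And>x. x \<notin> K \<Longrightarrow> u x = 0" "\<And>x v. x \<notin> K \<Longrightarrow> u' x v = 0"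
    using C1_compact_supportE[OF u] by blast
  \<comment> \<open>Contains the supports of all difference quotients with step at most \<open>1\<close>.\<close>
  define K' where "K' = {x + y | x y. x \<in> K \<and> y \<in> cball 0 (norm v)}"
  have "compact K'"
    unfolding K'_def using K(1) by (intro compact_sums) auto
  have K': "x \<in> K'" if "x + s *\<^sub>R v \<in> K" "\<bar>s\<bar> \<le> 1" for x s
  proof -
    have "norm (- (s *\<^sub>R v)) \<le> norm v"
      using that(2) by (simp add: mult_left_le_one_le)
    then show ?thesis
      unfolding K'_def using that(1) by (intro CollectI exI[of _ "x + s *\<^sub>R v"] exI[of _ "- (s *\<^sub>R v)"]) simp
  qed
  have "bounded ((\<lambda>x. u' x v) ` K)"
    using K(1) cu' by (intro compact_imp_bounded compact_continuous_image) (auto intro: continuous_on_subset)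
  then obtain M where M: "\<And>x. x \<in> K \<Longrightarrow> \<bar>u' x v\<bar> \<le> M" "M > 0"
    unfolding bounded_pos by auto
  have M': "\<bar>u' x v\<bar> \<le> M" for x
    using M K(3) by (cases "x \<in> K") auto
  have "bounded (g ` K')"
    using \<open>compact K'\<close> g by (intro compact_imp_bounded compact_continuous_image) (auto intro: continuous_on_subset)
  then obtain B where B: "\<And>x. x \<in> K' \<Longrightarrow> \<bar>g x\<bar> \<le> B" "B > 0"
    unfolding bounded_pos by auto
  have line: "((\<lambda>s. u (x + s *\<^sub>R v)) has_field_derivative u' (x + s *\<^sub>R v) v) (at s within S)" for x s S
  proof -
    have "((\<lambda>s. u (x + s *\<^sub>R v)) has_derivative (\<lambda>r. u' (x + s *\<^sub>R v) (r *\<^sub>R v))) (at s within S)"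
      by (rule has_derivative_compose[OF _ du]) (auto intro!: derivative_eq_intros)
    moreover have "(\<lambda>r. u' (x + s *\<^sub>R v) (r *\<^sub>R v)) = (*) (u' (x + s *\<^sub>R v) v)"
      using linear_scale[OF has_derivative_linear[OF du]] by (simp add: fun_eq_iff mult.commute)
    ultimately show ?thesis
      by (simp add: has_field_derivative_def)
  qed
  have quot_bound: "\<bar>(u (x + s *\<^sub>R v) - u x) / s\<bar> \<le> M" if "s > 0" for x s
  proof -
    have "norm (u (x + s *\<^sub>R v) - u (x + 0 *\<^sub>R v)) \<le> M * norm (s - 0)"
      by (rule field_differentiable_bound[of UNIV "\<lambda>s. u (x + s *\<^sub>R v)"])
        (auto intro: line M')
    then show ?thesis using that by (simp add: divide_le_eq)
  qed
  define h where "h n = inverse (real (Suc n))" for n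
  have h: "h n > 0" "\<bar>h n\<bar> \<le> 1" for n
    by (auto simp: h_def field_simps)
  show ?thesis
    unfolding h_def[symmetric]
  proof (rule integral_dominated_convergence[where w = "\<lambda>x. M * B * indicator K' x"])
    have cu: "continuous_on UNIV u" by (rule C1_compact_support_continuous[OF u])
    then have "continuous_on UNIV (\<lambda>x. (u (x + h n *\<^sub>R v) - u x) / h n * g x)" for n
      unfolding divide_inverse
      by (intro continuous_intros g cu continuous_on_compose2[OF cu, of UNIV "\<lambda>x. x + h n *\<^sub>R v"]) auto
    then show "(\<lambda>x. (u (x + h n *\<^sub>R v) - u x) / h n * g x) \<in> borel_measurable lborel" for n
      by (simp add: borel_measurable_continuous_onI)
    show "(\<lambda>x. u' x v * g x) \<in> borel_measurable lborel"
      using cu' g by (simp add: borel_measurable_continuous_onI continuous_on_mult)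
    show "integrable lborel (\<lambda>x. M * B * indicator K' x)"
      using borel_integrable_compact[of K' "\<lambda>_. M * B"] \<open>compact K'\<close> by (simp add: mult.commute)
    show "AE x in lborel. (\<lambda>n. (u (x + h n *\<^sub>R v) - u x) / h n * g x) \<longlonglongrightarrow> u' x v * g x"
    proof (rule AE_I2)
      fix x
      have "(\<lambda>s. (u (x + s *\<^sub>R v) - u x) / s) \<midarrow>0\<rightarrow> u' x v"
        using line[of x 0 UNIV] by (simp add: DERIV_def)
      moreover have "filterlim h (at 0) sequentially"
        using LIMSEQ_inverse_real_of_nat h(1) unfolding filterlim_at h_def
        by (auto intro: always_eventually)
      ultimately have "(\<lambda>n. (u (x + h n *\<^sub>R v) - u x) / h n) \<longlonglongrightarrow> u' x v"
        by (rule filterlim_compose)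
      then show "(\<lambda>n. (u (x + h n *\<^sub>R v) - u x) / h n * g x) \<longlonglongrightarrow> u' x v * g x"
        by (intro tendsto_mult_right)
    qed
    show "AE x in lborel. norm ((u (x + h n *\<^sub>R v) - u x) / h n * g x) \<le> M * B * indicator K' x" for n
    proof (rule AE_I2)
      fix x
      show "norm ((u (x + h n *\<^sub>R v) - u x) / h n * g x) \<le> M * B * indicator K' x"
      proof (cases "x \<in> K'")
        case True
        have "\<bar>(u (x + h n *\<^sub>R v) - u x) / h n\<bar> * \<bar>g x\<bar> \<le> M * B"
          using quot_bound[OF h(1)] B(1)[OF True] M(2) by (intro mult_mono) auto
        with True show ?thesis by (simp add: abs_mult)
      next
        case False
        then have "u (x + h n *\<^sub>R v) = 0" "u x = 0"
          using K'[of x "h n"] K'[of x 0] h(2)[of n] K(2) by auto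
        with False show ?thesis by simp
      qed
    qed
  qed
qed

text \<open>By translation invariance of Lebesgue measure the difference quotients of \<open>u\<close> have integral zero;
  pass to the limit.\<close>

lemma integral_directional_derivative_zero:
  assumes u: "C1_compact_support u u'"
  shows "(LINT x|lborel. u' x v) = 0"
proof -
  obtain K where K: "compact K" "\<And>x. x \<notin> K \<Longrightarrow> u x = 0"
    using u unfolding C1_compact_support_def by blast
  have cu: "continuous_on UNIV u" by (rule C1_compact_support_continuous[OF u])
  have int: "integrable lborel u"
    using integrable_continuous_compact_support[OF cu K] .
  have "(LINT x|lborel. (u (x + a) - u x) / h) = 0" for a h
  proof -
    have "integrable lborel (\<lambda>x. u (x + a))"
    proof (rule integrable_continuous_compact_support)
      show "continuous_on UNIV (\<lambda>x. u (x + a))"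
        by (intro continuous_on_compose2[OF cu] continuous_intros) auto
      show "compact ((\<lambda>y. y - a) ` K)"
        using K(1) by (intro compact_continuous_image continuous_intros)
      show "u (x + a) = 0" if "x \<notin> (\<lambda>y. y - a) ` K" for x
        using that by (intro K(2)) (metis add_diff_cancel_right' image_eqI)
    qed
    then show ?thesis
      using int lborel_integral_translate[of u a] cu by (simp add: borel_measurable_continuous_onI)
  qed
  then have "(\<lambda>n. 0) \<longlonglongrightarrow> (LINT x|lborel. u' x v)"
    using integral_diff_quotient_tendsto[OF u continuous_on_const[of UNIV 1], of v]
    by (simp del: of_nat_Suc integral_divide_zero)
  then show ?thesis
    by (simp add: LIMSEQ_const_iff)
qed

lemma C1_compact_support_integrable:
  assumes u: "C1_compact_support u u'" and g: "continuous_on UNIV g"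
  shows "integrable lborel (\<lambda>x. u x * g x)" "integrable lborel (\<lambda>x. u' x d * g x)"
proof -
  obtain K where K: "compact K" "\<And>x. x \<notin> K \<Longrightarrow> u x = 0" "\<And>x v. x \<notin> K \<Longrightarrow> u' x v = 0"
    using C1_compact_supportE[OF u] by blast
  have "continuous_on UNIV (\<lambda>x. u' x d)"
    using u by (simp add: C1_compact_support_def)
  then show "integrable lborel (\<lambda>x. u x * g x)" "integrable lborel (\<lambda>x. u' x d * g x)"
    using K C1_compact_support_continuous[OF u] g
    by (auto intro!: integrable_continuous_compact_support[of _ K] continuous_intros)
qed

lemma integral_by_parts_C1:
  assumes u: "C1_compact_support u u'" and v: "C1_compact_support v v'"
  shows "(LINT x|lborel. u x * v' x d) = - (LINT x|lborel. u' x d * v x)"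
proof -
  have c: "continuous_on UNIV v" "continuous_on UNIV (\<lambda>x. v' x d)"
    using v C1_compact_support_continuous[OF v] by (simp_all add: C1_compact_support_def)
  have "(LINT x|lborel. u x * v' x d + u' x d * v x) = 0"
    by (rule integral_directional_derivative_zero[OF C1_compact_support_mult[OF u v]])
  then show ?thesis
    using C1_compact_support_integrable[OF u] c by simp
qed

text \<open>For smooth functions this is two integrations by parts and the symmetry of second derivatives.
  For functions that are only \<open>C\<^sup>1\<close>, replace one derivative by a difference quotient: it can be moved
  from \<open>u\<close> to \<open>v\<close> by translation, and the other derivative by one integration by parts.\<close>

lemma integral_derivatives_commute:
  assumes u: "C1_compact_support u u'" and v: "C1_compact_support v v'"
  shows "(LINT x|lborel. u' x d * v' x e) = (LINT x|lborel. u' x e * v' x d)"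
proof (rule LIMSEQ_unique)
  define h where "h n = inverse (real (Suc n))" for n
  have cu': "continuous_on UNIV (\<lambda>x. u' x e)" and cv': "continuous_on UNIV (\<lambda>x. v' x e)"
    using u v by (simp_all add: C1_compact_support_def)
  have cv: "continuous_on UNIV v" by (rule C1_compact_support_continuous[OF v])
  show "(\<lambda>n. LINT x|lborel. (u (x + h n *\<^sub>R d) - u x) / h n * v' x e)
      \<longlonglongrightarrow> (LINT x|lborel. u' x d * v' x e)"
    unfolding h_def by (rule integral_diff_quotient_tendsto[OF u cv'])
  have "(\<lambda>n. LINT x|lborel. (v (x + h n *\<^sub>R (- d)) - v x) / h n * u' x e)
      \<longlonglongrightarrow> (LINT x|lborel. v' x (- d) * u' x e)"
    unfolding h_def by (rule integral_diff_quotient_tendsto[OF v cu'])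
  moreover have "v' x (- d) = - v' x d" for x
    using v linear_neg[OF has_derivative_linear] unfolding C1_compact_support_def by blast
  ultimately have "(\<lambda>n. - (LINT x|lborel. (v (x + h n *\<^sub>R (- d)) - v x) / h n * u' x e))
      \<longlonglongrightarrow> (LINT x|lborel. u' x e * v' x d)"
    using tendsto_minus by (fastforce simp: mult.commute)
  moreover have "- (LINT x|lborel. (v (x + h n *\<^sub>R (- d)) - v x) / h n * u' x e)
      = (LINT x|lborel. (u (x + h n *\<^sub>R d) - u x) / h n * v' x e)" for n
  proof -
    let ?a = "h n *\<^sub>R d"
    have cvt: "continuous_on UNIV (\<lambda>x. v (x - ?a))"
      by (intro continuous_on_compose2[OF cv] continuous_intros) auto
    have cut: "continuous_on UNIV (\<lambda>x. u' (x + ?a) e)"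
      by (intro continuous_on_compose2[OF cu'] continuous_intros) auto
    obtain K where K: "compact K" "\<And>x. x \<notin> K \<Longrightarrow> v x = 0"
      using v unfolding C1_compact_support_def by blast
    have int1: "integrable lborel (\<lambda>x. u' (x + ?a) e * v x)"
      using K cut cv by (auto intro!: integrable_continuous_compact_support[of _ K] continuous_intros)
    have "(LINT x|lborel. (u (x + ?a) - u x) / h n * v' x e)
        = - (LINT x|lborel. (u' (x + ?a) e - u' x e) / h n * v x)"
      by (rule integral_by_parts_C1[OF C1_compact_support_diff_quotient[OF u] v])
    also have "(LINT x|lborel. (u' (x + ?a) e - u' x e) / h n * v x)
        = ((LINT x|lborel. u' (x + ?a) e * v x) - (LINT x|lborel. u' x e * v x)) / h n"
      using int1 C1_compact_support_integrable(2)[OF u cv, of e]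
      by (simp add: left_diff_distrib diff_divide_distrib)
    also have "(LINT x|lborel. u' (x + ?a) e * v x) = (LINT x|lborel. u' x e * v (x - ?a))"
    proof -
      have "(\<lambda>x. u' x e * v (x - ?a)) \<in> borel_measurable borel"
        using cu' cvt by (intro borel_measurable_continuous_onI continuous_intros)
      from lborel_integral_translate[OF this, of ?a] show ?thesis by simp
    qed
    also have "((LINT x|lborel. u' x e * v (x - ?a)) - (LINT x|lborel. u' x e * v x)) / h n
        = (LINT x|lborel. (v (x + h n *\<^sub>R (- d)) - v x) / h n * u' x e)"
      using C1_compact_support_integrable(2)[OF u cv, of e]
        C1_compact_support_integrable(2)[OF u cvt, of e]
      by (simp add: left_diff_distrib right_diff_distrib diff_divide_distrib mult.commute)
    finally show ?thesis by simp
  qed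
  ultimately show "(\<lambda>n. LINT x|lborel. (u (x + h n *\<^sub>R d) - u x) / h n * v' x e)
      \<longlonglongrightarrow> (LINT x|lborel. u' x e * v' x d)"
    by simp
qed

lemma test_function_component_C1:
  assumes "test_function \<Omega> \<theta>"
  shows "C1_compact_support (\<lambda>x. \<theta> x $ i) (\<lambda>x v. frechet_derivative \<theta> (at x) v $ i)"
  unfolding C1_compact_support_def
proof (intro conjI allI)
  have t: "times_cont_diff (Suc 0) \<theta>"
    using assms by (simp add: test_function_def del: times_cont_diff.simps)
  then have "(\<theta> has_derivative frechet_derivative \<theta> (at x)) (at x)" for x
    by (simp flip: frechet_derivative_works)
  then show "((\<lambda>x. \<theta> x $ i) has_derivative (\<lambda>v. frechet_derivative \<theta> (at x) v $ i)) (at x)" for x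
    by (rule bounded_linear.has_derivative[OF bounded_linear_vec_nth])
  show "continuous_on UNIV (\<lambda>x. frechet_derivative \<theta> (at x) v $ i)" for v
    using t by (intro continuous_intros) auto
  have "\<theta> x $ i = 0" if "x \<notin> closure (support_on UNIV \<theta>)" for x
  proof -
    have "x \<notin> support_on UNIV \<theta>"
      using that closure_subset by blast
    then show ?thesis by (simp add: support_on_def)
  qed
  then show "\<exists>K. compact K \<and> (\<forall>x. x \<notin> K \<longrightarrow> \<theta> x $ i = 0)"
    using assms unfolding test_function_def by blast
qed

lemma jacobian_nth:
  "jacobian \<theta> (at x) $ i $ j = frechet_derivative \<theta> (at x) (axis j 1) $ i"
  by (simp add: jacobian_def matrix_def)

lemma continuous_on_matrix:
  fixes A :: "'a::topological_space \<Rightarrow> real^'n^'m"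
  assumes "\<And>i j. continuous_on S (\<lambda>x. A x $ i $ j)"
  shows "continuous_on S A"
proof -
  have "continuous_on S (\<lambda>x. \<chi> i j. A x $ i $ j)"
    by (intro continuous_intros assms)
  then show ?thesis by simp
qed

lemma test_function_jacobian:
  assumes "test_function \<Omega> \<theta>"
  shows "continuous_on UNIV (\<lambda>x. jacobian \<theta> (at x))"
    and "\<And>x. x \<notin> closure (support_on UNIV \<theta>) \<Longrightarrow> jacobian \<theta> (at x) = 0"
proof -
  show "continuous_on UNIV (\<lambda>x. jacobian \<theta> (at x))"
    using test_function_component_C1[OF assms]
    by (intro continuous_on_matrix) (simp add: jacobian_nth C1_compact_support_def)
  show "jacobian \<theta> (at x) = 0" if x: "x \<notin> closure (support_on UNIV \<theta>)" for x
  proof -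
    have "(\<theta> has_derivative frechet_derivative \<theta> (at x)) (at x)"
      using assms unfolding test_function_def
      by (metis frechet_derivative_works times_cont_diff.simps(2))
    then have "frechet_derivative \<theta> (at x) = (\<lambda>v. 0)"
      by (rule has_derivative_zero_outside_closed[OF _ closed_closure _ x])
        (use closure_subset[of "support_on UNIV \<theta>"] in \<open>auto simp: support_on_def\<close>)
    then show ?thesis
      by (simp add: vec_eq_iff jacobian_nth)
  qed
qed

text \<open>Entries of the Jacobian matrix are derivatives of compactly supported functions.\<close>

lemma integral_jacobian_zero:
  assumes "test_function \<Omega> \<theta>"
  shows "integrable lborel (\<lambda>x. jacobian \<theta> (at x))"
    and "(LINT x|lborel. jacobian \<theta> (at x)) = 0"
proof -
  have comp: "compact (closure (support_on UNIV \<theta>))"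
    using assms by (simp add: test_function_def)
  show int: "integrable lborel (\<lambda>x. jacobian \<theta> (at x))"
    using integrable_continuous_compact_support[OF test_function_jacobian(1)[OF assms] comp
        test_function_jacobian(2)[OF assms]] .
  have "(LINT x|lborel. jacobian \<theta> (at x)) $ i $ j = 0" for i j
  proof -
    have bl: "bounded_linear (\<lambda>A::real^2^2. A $ i $ j)"
      using bounded_linear_compose[OF bounded_linear_vec_nth bounded_linear_vec_nth] .
    show ?thesis
      using integral_bounded_linear[OF bl int]
        integral_directional_derivative_zero[OF test_function_component_C1[OF assms]]
      by (simp add: jacobian_nth)
  qed
  then show "(LINT x|lborel. jacobian \<theta> (at x)) = 0"
    by (simp add: vec_eq_iff)
qed

text \<open>The determinant is the difference of \<open>\<partial>\<^sub>1\<theta>\<^sub>1 \<partial>\<^sub>2\<theta>\<^sub>2\<close> and \<open>\<partial>\<^sub>2\<theta>\<^sub>1 \<partial>\<^sub>1\<theta>\<^sub>2\<close>, which have the same integral.\<close>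

lemma integral_det_jacobian_zero:
  assumes "test_function \<Omega> \<theta>"
  shows "integrable lborel (\<lambda>x. det (jacobian \<theta> (at x)))"
    and "(LINT x|lborel. det (jacobian \<theta> (at x))) = 0"
proof -
  note C1 = test_function_component_C1[OF assms]
  have prod: "integrable lborel (\<lambda>x. jacobian \<theta> (at x) $ i $ j * jacobian \<theta> (at x) $ k $ l)" for i j k l
    using C1_compact_support_integrable(2)[OF C1[of i], of "\<lambda>x. jacobian \<theta> (at x) $ k $ l" "axis j 1"]
      C1[of k] by (simp add: jacobian_nth C1_compact_support_def)
  then show "integrable lborel (\<lambda>x. det (jacobian \<theta> (at x)))"
    by (simp add: det_2)
  have "(LINT x|lborel. det (jacobian \<theta> (at x)))
      = (LINT x|lborel. jacobian \<theta> (at x) $ 1 $ 1 * jacobian \<theta> (at x) $ 2 $ 2)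
      - (LINT x|lborel. jacobian \<theta> (at x) $ 1 $ 2 * jacobian \<theta> (at x) $ 2 $ 1)"
    by (simp add: det_2 prod)
  also have "\<dots> = 0"
    using integral_derivatives_commute[OF C1[of 1] C1[of 2], of "axis 1 1" "axis 2 1"]
    by (simp add: jacobian_nth)
  finally show "(LINT x|lborel. det (jacobian \<theta> (at x))) = 0" .
qed

text \<open>Outside the compact support of \<open>\<theta>\<close> the gradient field equals \<open>F0\<close>. Hence its range lies in a compact
  subset of \<open>GL\<^sup>+(2)\<close>, on which \<open>w\<close> is bounded.\<close>

lemma set_integrable_compose_jacobian:
  fixes w :: "real^2^2 \<Rightarrow> real"
  assumes meas: "w \<in> borel_measurable (restrict_space borel GLp)"
    and lb: "\<And>K. compact K \<Longrightarrow> K \<subseteq> GLp \<Longrightarrow> bounded (w ` K)"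
    and F0: "F0 \<in> GLp" and \<Omega>: "open \<Omega>" "bounded \<Omega>" and test: "test_function \<Omega> \<theta>"
    and pos: "\<And>x. x \<in> \<Omega> \<Longrightarrow> F0 + jacobian \<theta> (at x) \<in> GLp"
  shows "set_integrable lborel \<Omega> (\<lambda>x. w (F0 + jacobian \<theta> (at x)))"
proof -
  define S where "S = closure (support_on UNIV \<theta>)"
  have S: "compact S" "S \<subseteq> \<Omega>"
    using test by (simp_all add: S_def test_function_def)
  have D0: "jacobian \<theta> (at x) = 0" if "x \<notin> S" for x
    using test_function_jacobian(2)[OF test] that by (simp add: S_def)
  have GLp: "F0 + jacobian \<theta> (at x) \<in> GLp" for x
    using pos[of x] D0[of x] F0 S(2) by (cases "x \<in> S") auto
  define K where "K = insert F0 ((\<lambda>x. F0 + jacobian \<theta> (at x)) ` S)"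
  have cont: "continuous_on UNIV (\<lambda>x. F0 + jacobian \<theta> (at x))"
    using test_function_jacobian(1)[OF test] by (intro continuous_intros)
  have "compact K"
    unfolding K_def using S(1) cont
    by (intro compact_insert compact_continuous_image) (auto intro: continuous_on_subset)
  moreover have "K \<subseteq> GLp"
    using GLp F0 by (auto simp: K_def)
  ultimately obtain B where B: "\<And>F. F \<in> K \<Longrightarrow> \<bar>w F\<bar> \<le> B"
    using lb[of K] unfolding bounded_iff by auto
  have in_K: "F0 + jacobian \<theta> (at x) \<in> K" for x
    using D0[of x] by (cases "x \<in> S") (auto simp: K_def)
  have m: "(\<lambda>x. w (F0 + jacobian \<theta> (at x))) \<in> borel_measurable borel"
  proof (rule measurable_compose[OF _ meas])
    show "(\<lambda>x. F0 + jacobian \<theta> (at x)) \<in> borel \<rightarrow>\<^sub>M restrict_space borel GLp"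
      using cont GLp by (intro measurable_restrict_space2 borel_measurable_continuous_onI) auto
  qed
  show ?thesis
    unfolding set_integrable_def
  proof (rule integrableI_bounded_set_indicator)
    show "\<Omega> \<in> sets lborel" using \<Omega>(1) by simp
    show "emeasure lborel \<Omega> < \<infinity>" using \<Omega>(2) by (rule emeasure_bounded_finite)
    show "(\<lambda>x. w (F0 + jacobian \<theta> (at x))) \<in> borel_measurable lborel" using m by simp
    show "AE x in lborel. x \<in> \<Omega> \<longrightarrow> norm (w (F0 + jacobian \<theta> (at x))) \<le> B"
      using B[OF in_K] by simp
  qed
qed

text \<open>Insert the gradient field into the minorant at \<open>F0\<close> and integrate: all terms but \<open>w F0\<close> have
  integral zero.\<close>

lemma quasiconvex_if_minorants:
  assumes minor: "has_polyaffine_minorants w" and cont: "continuous_on GLp w"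
  shows "quasiconvex w"
proof -
  have meas: "w \<in> borel_measurable (restrict_space borel GLp)"
    using cont by (rule borel_measurable_continuous_on_restrict)
  have lb: "bounded (w ` K)" if "compact K" "K \<subseteq> GLp" for K
    using that cont by (intro compact_imp_bounded compact_continuous_image) (auto intro: continuous_on_subset)
  have "w F0 * measure lborel \<Omega> \<le> (LINT x:\<Omega>|lborel. w (F0 + jacobian \<theta> (at x)))"
    if F0: "F0 \<in> GLp" and \<Omega>: "open \<Omega>" "bounded \<Omega>" and test: "test_function \<Omega> \<theta>"
      and pos: "\<And>x. x \<in> \<Omega> \<Longrightarrow> F0 + jacobian \<theta> (at x) \<in> GLp" for F0 \<Omega> \<theta>
  proof -
    define D where "D x = jacobian \<theta> (at x)" for x
    obtain l c where l: "linear l"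
      and le: "\<And>F. F \<in> GLp \<Longrightarrow> w F0 + l (F - F0) + c * (det F - det F0) \<le> w F"
      using minor F0 unfolding has_polyaffine_minorants_def by blast
    \<comment> \<open>The linear part of the minorant in the increment \<open>A\<close>; what remains is \<open>c * det A\<close>.\<close>
    define m where "m A = l A + c * (det (F0 + A) - det F0 - det A)" for A
    have "linear m"
      unfolding m_def using linear_add[OF l] linear_scale[OF l]
      by (intro linearI) (simp_all add: det_2 algebra_simps)
    then have m: "bounded_linear m" by (simp add: linear_conv_bounded_linear)
    have D0: "D x = 0" if "x \<notin> \<Omega>" for x
      using test_function_jacobian(2)[OF test, of x] that test by (auto simp: D_def test_function_def)
    have fin: "emeasure lborel \<Omega> < \<infinity>" using \<Omega>(2) by (rule emeasure_bounded_finite)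
    have int: "integrable lborel (\<lambda>x. m (D x) + c * det (D x))"
      unfolding D_def using integrable_bounded_linear[OF m integral_jacobian_zero(1)[OF test]]
        integral_det_jacobian_zero(1)[OF test] by auto
    have "(LINT x|lborel. m (D x) + c * det (D x)) = 0"
      unfolding D_def using integrable_bounded_linear[OF m integral_jacobian_zero(1)[OF test]]
        integral_det_jacobian_zero[OF test] integral_bounded_linear[OF m integral_jacobian_zero(1)[OF test]]
        integral_jacobian_zero(2)[OF test] linear_0[OF \<open>linear m\<close>]
      by simp
    moreover have "(LINT x|lborel. m (D x) + c * det (D x)) = (LINT x:\<Omega>|lborel. m (D x) + c * det (D x))"
      unfolding set_lebesgue_integral_def using D0 linear_0[OF \<open>linear m\<close>]
      by (intro Bochner_Integration.integral_cong) (auto simp: indicator_def det_2)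
    ultimately have zero: "(LINT x:\<Omega>|lborel. m (D x) + c * det (D x)) = 0" by simp
    have sint: "set_integrable lborel \<Omega> (\<lambda>x. m (D x) + c * det (D x))"
      unfolding set_integrable_def using int \<Omega>(1) by (intro integrable_mult_indicator) auto
    have sconst: "set_integrable lborel \<Omega> (\<lambda>x. w F0)"
      unfolding set_integrable_def using \<Omega>(1) fin by simp
    have "w F0 * measure lborel \<Omega> = (LINT x:\<Omega>|lborel. w F0 + (m (D x) + c * det (D x)))"
      using set_integral_add(2)[OF sconst sint] zero fin \<Omega>(1)
      by (simp add: set_lebesgue_integral_def mult.commute)
    also have "\<dots> \<le> (LINT x:\<Omega>|lborel. w (F0 + D x))"
    proof (rule set_integral_mono)
      show "set_integrable lborel \<Omega> (\<lambda>x. w F0 + (m (D x) + c * det (D x)))"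
        by (rule set_integral_add(1)[OF sconst sint])
      show "set_integrable lborel \<Omega> (\<lambda>x. w (F0 + D x))"
        unfolding D_def by (rule set_integrable_compose_jacobian[OF meas lb F0 \<Omega> test pos])
      show "w F0 + (m (D x) + c * det (D x)) \<le> w (F0 + D x)" if "x \<in> \<Omega>" for x
        using le[of "F0 + D x"] pos[OF that] by (simp add: D_def m_def algebra_simps)
    qed
    finally show ?thesis by (simp add: D_def)
  qed
  with meas lb show ?thesis
    unfolding quasiconvex_def by blast
qed


section \<open>Smooth functions of a real variable\<close>

lemma times_cont_diff_SucI:
  assumes "\<And>x. (f has_derivative f' x) (at x)" "\<And>v. times_cont_diff k (\<lambda>x. f' x v)"
  shows "times_cont_diff (Suc k) f"
proof -
  have "frechet_derivative f (at x) = f' x" for x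
    using frechet_derivative_at[OF assms(1)] by simp
  then show ?thesis
    using assms by (auto simp: differentiable_def)
qed

lemma times_cont_diff_has_derivative:
  "times_cont_diff (Suc k) f \<Longrightarrow> (f has_derivative frechet_derivative f (at x)) (at x)"
  by (simp flip: frechet_derivative_works)

lemma times_cont_diff_SucD: "times_cont_diff (Suc k) f \<Longrightarrow> times_cont_diff k f"
proof (induction k arbitrary: f)
  case 0
  then show ?case
    by (auto intro!: differentiable_imp_continuous_on simp: differentiable_on_def differentiable_at_withinI)
next
  case (Suc k)
  then show ?case
    by (metis times_cont_diff.simps(2))
qed

lemma times_cont_diff_bounded_linear:
  assumes L: "bounded_linear L" and f: "times_cont_diff k f"
  shows "times_cont_diff k (\<lambda>x. L (f x))"
  using f
proof (induction k arbitrary: f)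
  case 0
  then show ?case
    by (auto intro: bounded_linear.continuous_on[OF L])
next
  case (Suc k)
  show ?case
    by (rule times_cont_diff_SucI[OF bounded_linear.has_derivative[OF L
          times_cont_diff_has_derivative[OF Suc.prems]]]) (use Suc in auto)
qed

lemma times_cont_diff_add:
  "times_cont_diff k f \<Longrightarrow> times_cont_diff k g \<Longrightarrow> times_cont_diff k (\<lambda>x. f x + g x)"
proof (induction k arbitrary: f g)
  case (Suc k)
  show ?case
    by (rule times_cont_diff_SucI[OF has_derivative_add[OF
          times_cont_diff_has_derivative[OF Suc.prems(1)]
          times_cont_diff_has_derivative[OF Suc.prems(2)]]]) (use Suc in auto)
qed (auto intro: continuous_intros)

lemma times_cont_diff_cmult:
  fixes f :: "_ \<Rightarrow> real"
  shows "times_cont_diff k f \<Longrightarrow> times_cont_diff k (\<lambda>x. c * f x)"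
  by (rule times_cont_diff_bounded_linear[OF bounded_linear_mult_right])

lemma times_cont_diff_diff:
  fixes f g :: "_ \<Rightarrow> real"
  shows "times_cont_diff k f \<Longrightarrow> times_cont_diff k g \<Longrightarrow> times_cont_diff k (\<lambda>x. f x - g x)"
  using times_cont_diff_add[of k f "\<lambda>x. (-1) * g x"] times_cont_diff_cmult[of k g "-1"] by simp

lemma times_cont_diff_mult:
  fixes f g :: "_ \<Rightarrow> real"
  shows "times_cont_diff k f \<Longrightarrow> times_cont_diff k g \<Longrightarrow> times_cont_diff k (\<lambda>x. f x * g x)"
proof (induction k arbitrary: f g)
  case (Suc k)
  have "times_cont_diff k f" "times_cont_diff k g"
    using Suc.prems by (blast intro: times_cont_diff_SucD)+
  with Suc show ?case
    by (intro times_cont_diff_SucI[OF has_derivative_mult[OF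
          times_cont_diff_has_derivative[OF Suc.prems(1)]
          times_cont_diff_has_derivative[OF Suc.prems(2)]]] times_cont_diff_add) auto
qed (auto intro: continuous_intros)

lemma times_cont_diff_compose_affine:
  assumes L: "bounded_linear L" and f: "times_cont_diff k f"
  shows "times_cont_diff k (\<lambda>x. f (L x + c))"
  using f
proof (induction k arbitrary: f)
  case 0
  have "continuous_on UNIV (\<lambda>x. L x + c)"
    by (intro continuous_intros bounded_linear.continuous_on[OF L])
  then show ?case
    using 0 by (auto intro: continuous_on_compose2)
next
  case (Suc k)
  have "((\<lambda>x. f (L x + c)) has_derivative (\<lambda>v. frechet_derivative f (at (L x + c)) (L v))) (at x)" for x
    by (rule has_derivative_compose[OF _ times_cont_diff_has_derivative[OF Suc.prems]])
      (auto intro!: derivative_eq_intros bounded_linear.has_derivative[OF L])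
  then show ?case
    by (rule times_cont_diff_SucI) (use Suc in auto)
qed

lemma times_cont_diff_Suc_DERIV:
  fixes f :: "real \<Rightarrow> real"
  assumes "\<And>x. (f has_field_derivative f' x) (at x)" "times_cont_diff k f'"
  shows "times_cont_diff (Suc k) f"
proof (rule times_cont_diff_SucI)
  show "(f has_derivative (\<lambda>v. f' x * v)) (at x)" for x
    using assms(1) by (simp add: has_field_derivative_def)
  show "times_cont_diff k (\<lambda>x. f' x * v)" for v
    using times_cont_diff_cmult[OF assms(2), of v] by (simp add: mult.commute)
qed

lemma smooth_antiderivative:
  fixes f :: "real \<Rightarrow> real"
  assumes "\<And>x. (f has_field_derivative f' x) (at x)" "\<And>k. times_cont_diff k f'"
  shows "times_cont_diff k f"
  using times_cont_diff_Suc_DERIV[OF assms] by (rule times_cont_diff_SucD)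

text \<open>The function \<open>exp (-1/x)\<close> extended by zero is smooth. Allowing powers of \<open>1/x\<close> as factors makes the
  family closed under differentiation up to linear combinations, so smoothness follows by induction.\<close>

definition flat :: "nat \<Rightarrow> real \<Rightarrow> real" where
  "flat k x = (if x > 0 then exp (- (1 / x)) / x ^ k else 0)"

lemma flat_tendsto_0: "(flat k \<longlongrightarrow> 0) (at 0)"
proof -
  have "((\<lambda>x::real. inverse x ^ k / exp (inverse x)) \<longlongrightarrow> 0) (at_right 0)"
    by (rule filterlim_compose[OF tendsto_power_div_exp_0 filterlim_inverse_at_top_right])
  moreover have "\<forall>\<^sub>F x in at_right 0. inverse x ^ k / exp (inverse x) = flat k x"
    by (auto simp: eventually_at_filter flat_def exp_minus field_simps)
  ultimately have "(flat k \<longlongrightarrow> 0) (at_right 0)"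
    by (rule Lim_transform_eventually)
  moreover have "(flat k \<longlongrightarrow> 0) (at_left 0)"
    by (rule tendsto_eventually) (auto simp: eventually_at_filter flat_def)
  ultimately show ?thesis
    by (simp add: filterlim_split_at)
qed

lemma flat_DERIV: "(flat k has_field_derivative flat (k + 2) x - k * flat (k + 1) x) (at x)"
proof (cases x "0::real" rule: linorder_cases)
  case less
  have "((\<lambda>_. 0) has_field_derivative 0) (at x)"
    by simp
  then have "(flat k has_field_derivative 0) (at x)"
    by (rule has_field_derivative_transform_within_open[of _ _ _ "{..<0}"]) (use less in \<open>auto simp: flat_def\<close>)
  with less show ?thesis by (simp add: flat_def)
next
  case equal
  have "((\<lambda>h. (flat k (0 + h) - flat k 0) / h) \<longlongrightarrow> 0) (at 0)"
  proof (rule Lim_transform_eventually[OF flat_tendsto_0])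
    show "\<forall>\<^sub>F h in at 0. flat (k + 1) h = (flat k (0 + h) - flat k 0) / h"
      by (auto simp: flat_def intro!: always_eventually)
  qed
  then have "(flat k has_field_derivative 0) (at 0)"
    by (simp add: DERIV_def)
  with equal show ?thesis by (simp add: flat_def)
next
  case greater
  have "((\<lambda>x. exp (- (1 / x))) has_field_derivative exp (- (1 / x)) / x\<^sup>2) (at x)"
    using greater by (auto intro!: derivative_eq_intros simp: power2_eq_square)
  from DERIV_divide[OF this DERIV_pow[of k x]] greater
  have "((\<lambda>x. exp (- (1 / x)) / x ^ k) has_field_derivative
      (exp (- (1 / x)) / x\<^sup>2 * x ^ k - exp (- (1 / x)) * (k * x ^ (k - Suc 0))) / (x ^ k * x ^ k)) (at x)"
    by simp
  also have "(exp (- (1 / x)) / x\<^sup>2 * x ^ k - exp (- (1 / x)) * (k * x ^ (k - Suc 0))) / (x ^ k * x ^ k)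
      = flat (k + 2) x - k * flat (k + 1) x"
  proof -
    have "k * x ^ (k - Suc 0) = k * x ^ k / x"
      using greater by (cases k) auto
    then show ?thesis
      using greater by (simp add: flat_def power_add power2_eq_square diff_divide_distrib)
  qed
  finally have "((\<lambda>x. exp (- (1 / x)) / x ^ k) has_field_derivative
      flat (k + 2) x - k * flat (k + 1) x) (at x)" .
  then show ?thesis
    by (rule has_field_derivative_transform_within_open[of _ _ _ "{0<..}"]) (use greater in \<open>auto simp: flat_def\<close>)
qed

lemma flat_smooth: "times_cont_diff j (flat k)"
proof (induction j arbitrary: k)
  case 0
  show ?case
    using DERIV_continuous_on[OF flat_DERIV] by simp
next
  case (Suc j)
  show ?case
    using flat_DERIV by (rule times_cont_diff_Suc_DERIV) (intro times_cont_diff_diff times_cont_diff_cmult Suc)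
qed

lemma ex_antiderivative:
  fixes f :: "real \<Rightarrow> real"
  assumes "continuous_on UNIV f"
  obtains F where "\<And>x. (F has_field_derivative f x) (at x)" "F 0 = 0"
proof -
  have "\<exists>F. \<forall>x::real. -\<infinity> < ereal x \<longrightarrow> ereal x < \<infinity> \<longrightarrow> (F has_vector_derivative f x) (at x)"
    using assms by (intro einterval_antiderivative) (auto simp: continuous_on_eq_continuous_at)
  then obtain F where F: "\<And>x. (F has_field_derivative f x) (at x)"
    by (auto simp: has_real_derivative_iff_has_vector_derivative)
  show ?thesis
    by (rule that[of "\<lambda>x. F x - F 0"]) (auto intro!: derivative_eq_intros F)
qed

lemma DERIV_zero_imp_eq:
  fixes f :: "real \<Rightarrow> real"
  assumes "\<And>x. (f has_field_derivative f' x) (at x)" "\<And>x. a \<le> x \<Longrightarrow> x \<le> b \<Longrightarrow> f' x = 0" "a \<le> b"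
  shows "f a = f b"
proof (cases "a = b")
  case False
  with assms(3) have "a < b" by simp
  then obtain z where "a < z" "z < b" "f b - f a = (b - a) * f' z"
    using MVT2[of a b f f'] assms(1) by blast
  with assms(2)[of z] show ?thesis by simp
qed simp

text \<open>The normalised antiderivative of the bump \<open>flat 0 x * flat 0 (1 - x)\<close>.\<close>

lemma ex_smooth_step:
  obtains S :: "real \<Rightarrow> real" where "\<And>k. times_cont_diff k S"
    "\<And>x. x \<le> 0 \<Longrightarrow> S x = 0" "\<And>x. x \<ge> 1 \<Longrightarrow> S x = 1" "\<And>x. 0 \<le> S x" "\<And>x. S x \<le> 1"
proof -
  define r where "r x = flat 0 x * flat 0 (1 - x)" for x
  have r_smooth: "times_cont_diff k r" for k
    unfolding r_def
    using times_cont_diff_compose_affine[OF bounded_linear_minus[OF bounded_linear_ident] flat_smooth, of k 0 1]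
    by (intro times_cont_diff_mult flat_smooth) (simp add: add.commute)
  have r: "r x \<ge> 0" "x \<le> 0 \<or> x \<ge> 1 \<Longrightarrow> r x = 0" "0 < x \<Longrightarrow> x < 1 \<Longrightarrow> r x > 0" for x
    by (auto simp: r_def flat_def)
  obtain F where F: "\<And>x. (F has_field_derivative r x) (at x)" "F 0 = 0"
    using ex_antiderivative[of r] r_smooth[of 0] by auto
  have mono: "F x \<le> F y" if "x \<le> y" for x y
    using that F(1) r(1) by (meson DERIV_nonneg_imp_nondecreasing)
  have "F 0 < F 1"
    by (rule DERIV_pos_imp_increasing_open)
      (use F(1) r(3) in \<open>auto intro!: DERIV_continuous_on intro: has_field_derivative_at_within\<close>)
  then have F1: "F 1 > 0" using F(2) by simp
  have neg: "F x = 0" if "x \<le> 0" for x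
    using DERIV_zero_imp_eq[of F r x 0] F r(2) that by auto
  have ge1: "F x = F 1" if "x \<ge> 1" for x
    using DERIV_zero_imp_eq[of F r 1 x] F r(2) that by auto
  have bounds: "0 \<le> F x \<and> F x \<le> F 1" for x
    using mono[of 0 x] mono[of x 1] neg[of x] ge1[of x] F1 F(2) by linarith
  show ?thesis
  proof (rule that[of "\<lambda>x. inverse (F 1) * F x"])
    show "times_cont_diff k (\<lambda>x. inverse (F 1) * F x)" for k
      by (intro times_cont_diff_cmult smooth_antiderivative[OF F(1)] r_smooth)
    show "inverse (F 1) * F x = 0" if "x \<le> 0" for x
      using neg[OF that] by simp
    show "inverse (F 1) * F x = 1" if "x \<ge> 1" for x
      using ge1[OF that] F1 by simp
    show "0 \<le> inverse (F 1) * F x" for x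
      using bounds F1 by simp
    show "inverse (F 1) * F x \<le> 1" for x
      using bounds[of x] F1 by (simp add: inverse_eq_divide)
  qed
qed

lemma ex_smooth_bump:
  fixes d :: real
  assumes "0 < d"
  obtains B :: "real \<Rightarrow> real" where "\<And>k. times_cont_diff k B"
    "\<And>x. 0 \<le> B x" "\<And>x. B x \<le> 1" "\<And>x. x \<le> d \<or> 1 - d \<le> x \<Longrightarrow> B x = 0"
    "\<And>x. 2 * d \<le> x \<Longrightarrow> x \<le> 1 - 2 * d \<Longrightarrow> B x = 1"
proof -
  obtain S :: "real \<Rightarrow> real" where S: "\<And>k. times_cont_diff k S"
    "\<And>x. x \<le> 0 \<Longrightarrow> S x = 0" "\<And>x. x \<ge> 1 \<Longrightarrow> S x = 1" "\<And>x. 0 \<le> S x" "\<And>x. S x \<le> 1"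
    using ex_smooth_step by blast
  define B where "B x = S (x / d + (- 1)) * S (- x / d + (1 - d) / d)" for x
  have "bounded_linear (\<lambda>x. - x / d)"
    using bounded_linear_minus[OF bounded_linear_divide[of d]] by simp
  then have "times_cont_diff k B" for k
    unfolding B_def by (intro times_cont_diff_mult times_cont_diff_compose_affine S(1) bounded_linear_divide)
  then show ?thesis
  proof (rule that)
    show "0 \<le> B x" "B x \<le> 1" for x
      using S(4,5) by (auto simp: B_def intro: mult_le_one)
    have eq: "B x = S ((x - d) / d) * S ((1 - d - x) / d)" for x
      using assms by (simp add: B_def diff_divide_distrib)
    show "B x = 0" if "x \<le> d \<or> 1 - d \<le> x" for x
      using that S(2)[of "(x - d) / d"] S(2)[of "(1 - d - x) / d"] assms
      by (auto simp: eq divide_le_0_iff)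
    show "B x = 1" if "2 * d \<le> x" "x \<le> 1 - 2 * d" for x
      using that S(3)[of "(x - d) / d"] S(3)[of "(1 - d - x) / d"] assms
      by (auto simp: eq le_divide_eq_1)
  qed
qed

text \<open>A smoothed tent over the unit interval, with slopes \<open>1 - t\<close> on a part of length nearly \<open>t\<close> and \<open>- t\<close>
  on a part of length nearly \<open>1 - t\<close>. Both slopes are cut off by rescaled copies of the same bump
  function, whose integrals are proportional to \<open>t\<close> and \<open>1 - t\<close>. The two halves therefore cancel
  exactly, and the tent returns to zero.\<close>

lemma ex_laminate_profile:
  fixes t d :: real
  assumes t: "0 < t" "t < 1" and d: "0 < d" "d < 1/4"
  obtains f f' e where "\<And>k. times_cont_diff k f" "\<And>x. (f has_field_derivative f' x) (at x)"
    "0 < e" "\<And>x. x < e \<or> 1 - e < x \<Longrightarrow> f x = 0"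
    "\<And>x. \<bar>f x\<bar> \<le> 1" "\<And>x. - t \<le> f' x" "\<And>x. f' x \<le> 1 - t"
    "\<And>x. 2 * d * t \<le> x \<Longrightarrow> x \<le> (1 - 2 * d) * t \<Longrightarrow> f' x = 1 - t"
    "\<And>x. t + 2 * d * (1 - t) \<le> x \<Longrightarrow> x \<le> t + (1 - 2 * d) * (1 - t) \<Longrightarrow> f' x = - t"
proof -
  obtain B :: "real \<Rightarrow> real" where B: "\<And>k. times_cont_diff k B"
    "\<And>x. 0 \<le> B x" "\<And>x. B x \<le> 1" "\<And>x. x \<le> d \<or> 1 - d \<le> x \<Longrightarrow> B x = 0"
    "\<And>x. 2 * d \<le> x \<Longrightarrow> x \<le> 1 - 2 * d \<Longrightarrow> B x = 1"
    using ex_smooth_bump[OF d(1)] by blast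
  obtain A where A: "\<And>x. (A has_field_derivative B x) (at x)" "A 0 = 0"
    using ex_antiderivative[of B] B(1)[of 0] by auto
  have mono: "A x \<le> A y" if "x \<le> y" for x y
    using that A(1) B(2) by (meson DERIV_nonneg_imp_nondecreasing)
  have A0: "A x = 0" if "x \<le> d" for x
  proof (cases "x \<le> 0")
    case True
    then show ?thesis using DERIV_zero_imp_eq[of A B x 0] A B(4) d by auto
  next
    case False
    then show ?thesis using DERIV_zero_imp_eq[of A B 0 x] A B(4) that by auto
  qed
  have A1: "A x = A 1" if "x \<ge> 1 - d" for x
  proof (cases "x \<le> 1")
    case True
    then show ?thesis using DERIV_zero_imp_eq[of A B x 1] A B(4) that by auto
  next
    case False
    then show ?thesis using DERIV_zero_imp_eq[of A B 1 x] A B(4) d by auto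
  qed
  have "A 1 \<le> 1"
  proof -
    have "A 1 - 1 \<le> A 0 - 0"
      by (rule DERIV_nonpos_imp_nonincreasing[of 0 1 "\<lambda>x. A x - x"])
        (auto intro!: derivative_eq_intros A(1) exI B(3) simp: B(3))
    then show ?thesis using A(2) by simp
  qed
  then have A_bounds: "0 \<le> A x" "A x \<le> 1" for x
    using mono[of 0 x] mono[of x 1] A0[of x] A1[of x] A(2) d by linarith+
  define f where "f x = t * (1 - t) * (A (x / t + 0) - A (x / (1 - t) + (- t / (1 - t))))" for x
  define f' where "f' x = (1 - t) * B (x / t) - t * B ((x - t) / (1 - t))" for x
  show ?thesis
  proof (rule that[of f f' "min (d * t) (d * (1 - t))"])
    show "times_cont_diff k f" for k
      unfolding f_def
      by (intro times_cont_diff_cmult times_cont_diff_diff times_cont_diff_compose_affine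
          bounded_linear_divide smooth_antiderivative[OF A(1)] B(1))
    show "(f has_field_derivative f' x) (at x)" for x
    proof -
      have "((\<lambda>x. A (x / t + 0)) has_field_derivative B (x / t + 0) * (1 / t)) (at x)"
        by (rule DERIV_chain2[OF A(1)]) (use t in \<open>auto intro!: derivative_eq_intros\<close>)
      moreover have "((\<lambda>x. A (x / (1 - t) + (- t / (1 - t)))) has_field_derivative
          B (x / (1 - t) + (- t / (1 - t))) * (1 / (1 - t))) (at x)"
        by (rule DERIV_chain2[OF A(1)]) (use t in \<open>auto intro!: derivative_eq_intros\<close>)
      ultimately have "(f has_field_derivative t * (1 - t) * (B (x / t + 0) * (1 / t)
          - B (x / (1 - t) + (- t / (1 - t))) * (1 / (1 - t)))) (at x)"
        unfolding f_def by (intro DERIV_cmult DERIV_diff)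
      also have "t * (1 - t) * (B (x / t + 0) * (1 / t)
          - B (x / (1 - t) + (- t / (1 - t))) * (1 / (1 - t))) = f' x"
      proof -
        have "t * (1 - t) * (b * (1 / t) - c * (1 / (1 - t))) = (1 - t) * b - t * c" for b c
          using t by (simp add: field_simps)
        then show ?thesis by (simp add: f'_def diff_divide_distrib)
      qed
      finally show ?thesis .
    qed
    show "0 < min (d * t) (d * (1 - t))" using t d by simp
    show "f x = 0" if "x < min (d * t) (d * (1 - t)) \<or> 1 - min (d * t) (d * (1 - t)) < x" for x
      using that
    proof
      assume x: "x < min (d * t) (d * (1 - t))"
      then have x: "x < d * t" "x < d * (1 - t)" by simp_all
      then have "x / t \<le> d" using t by (simp add: divide_le_eq)
      moreover have "x / (1 - t) + (- t / (1 - t)) \<le> 0"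
      proof -
        have "d * t < t" using t d by simp
        then have "(x - t) / (1 - t) \<le> 0"
          using x t by (intro divide_nonpos_pos) linarith+
        then show ?thesis by (simp add: diff_divide_distrib)
      qed
      ultimately show ?thesis using A0 d by (simp add: f_def)
    next
      assume x: "1 - min (d * t) (d * (1 - t)) < x"
      then have x: "1 - d * t < x" "1 - d * (1 - t) < x" by simp_all
      have "d * (1 - t) < 1 - t" using t d by simp
      then have "t \<le> x" using x by linarith
      then have "x / t \<ge> 1" using t by simp
      moreover have "x / (1 - t) + (- t / (1 - t)) \<ge> 1 - d"
      proof -
        have "1 - d \<le> (x - t) / (1 - t)"
          using x t by (subst pos_le_divide_eq) (simp_all add: left_diff_distrib right_diff_distrib)
        then show ?thesis by (simp add: diff_divide_distrib)
      qed
      ultimately show ?thesis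
        using A1[of "x / t"] A1[of "x / (1 - t) + (- t / (1 - t))"] d by (simp add: f_def)
    qed
    show "\<bar>f x\<bar> \<le> 1" for x
    proof -
      have "t * (1 - t) \<le> 1" "0 \<le> t * (1 - t)" using t by (auto intro: mult_le_one)
      moreover have "\<bar>A (x / t + 0) - A (x / (1 - t) + (- t / (1 - t)))\<bar> \<le> 1"
        using A_bounds[of "x / t + 0"] A_bounds[of "x / (1 - t) + (- t / (1 - t))"] by linarith
      ultimately show ?thesis
        unfolding f_def abs_mult using t by (intro mult_le_one) auto
    qed
    show "- t \<le> f' x" "f' x \<le> 1 - t" for x
    proof -
      have "0 \<le> (1 - t) * B (x / t)" "(1 - t) * B (x / t) \<le> 1 - t"
        "0 \<le> t * B ((x - t) / (1 - t))" "t * B ((x - t) / (1 - t)) \<le> t"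
        using t B(2,3) by (auto simp: mult_left_le)
      then show "- t \<le> f' x" "f' x \<le> 1 - t"
        unfolding f'_def by linarith+
    qed
    show "f' x = 1 - t" if "2 * d * t \<le> x" "x \<le> (1 - 2 * d) * t" for x
    proof -
      have "2 * d \<le> x / t" "x / t \<le> 1 - 2 * d"
        using that t by (simp_all add: le_divide_eq divide_le_eq)
      moreover have "x \<le> t"
      proof -
        have "(1 - 2 * d) * t \<le> 1 * t" using t d by (intro mult_right_mono) auto
        with that show ?thesis by simp
      qed
      then have "(x - t) / (1 - t) \<le> d"
        using t d divide_nonpos_pos[of "x - t" "1 - t"] by linarith
      ultimately show ?thesis
        using B(4,5) by (simp add: f'_def)
    qed
    show "f' x = - t" if "t + 2 * d * (1 - t) \<le> x" "x \<le> t + (1 - 2 * d) * (1 - t)" for x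
    proof -
      have "2 * d \<le> (x - t) / (1 - t)" "(x - t) / (1 - t) \<le> 1 - 2 * d"
        using that t by (simp_all add: le_divide_eq divide_le_eq)
      moreover have "0 \<le> 2 * d * (1 - t)" using t d by simp
      then have "t \<le> x"
        using that by linarith
      then have "x / t \<ge> 1 - d"
        using t d le_divide_eq_1_pos[of t x] by linarith
      ultimately show ?thesis
        using B(4,5) by (simp add: f'_def)
    qed
  qed
qed


section \<open>Quasiconvexity implies rank-one convexity\<close>

definition tensor :: "real^2 \<Rightarrow> real^2 \<Rightarrow> real^2^2" where
  "tensor a n = (\<chi> i j. a $ i * n $ j)"

lemma tensor_nth: "tensor a n $ i $ j = a $ i * n $ j"
  by (simp add: tensor_def)

lemma inner_vec2: "(x::real^2) \<bullet> y = x $ 1 * y $ 1 + x $ 2 * y $ 2"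
  by (simp add: inner_vec_def sum_2)

text \<open>A kernel vector of \<open>H\<close>, turned by a right angle, is the direction in which \<open>H\<close> acts.\<close>

lemma singular_eq_tensor:
  fixes H :: "real^2^2"
  assumes "det H = 0"
  obtains a n where "norm n = 1" "H = tensor a n"
proof -
  obtain v where v: "v \<noteq> 0" "H *v v = 0"
    using det_nz_iff_inj[of "(*v) H"] assms
    by (metis less_rank_noninjective linear_injective_0 matrix_of_matrix_vector_mul matrix_vector_mul_linear)
  define m where "m = v /\<^sub>R norm v"
  have m: "norm m = 1" "H *v m = 0"
    using v by (simp_all add: m_def matrix_vector_mult_scaleR)
  define n :: "real^2" where "n = vector [m $ 2, - m $ 1]"
  have n_nth: "n $ 1 = m $ 2" "n $ 2 = - m $ 1" by (simp_all add: n_def)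
  have unit: "m $ 1 * m $ 1 + m $ 2 * m $ 2 = 1"
    using m(1) by (metis inner_vec2 norm_eq_1)
  have ker: "H $ i $ 1 * m $ 1 + H $ i $ 2 * m $ 2 = 0" for i
    using m(2) by (auto simp: vec_eq_iff matrix_vector_mult_def sum_2)
  show ?thesis
  proof (rule that)
    show "norm n = 1"
      using unit by (simp add: norm_eq_1 inner_vec2 n_nth)
    have "H $ i $ 1 = (H *v n) $ i * n $ 1" "H $ i $ 2 = (H *v n) $ i * n $ 2" for i
      using ker[of i] unit unfolding matrix_vector_mult_def
      by (simp_all add: sum_2 n_nth) algebra+
    then show "H = tensor (H *v n) n"
      by (simp add: vec_eq_iff forall_2 tensor_nth)
  qed
qed

text \<open>The isometry that takes the standard basis to the orthonormal basis \<open>n, m\<close>, with its inverse.\<close>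

lemma orthonormal_frame_isometry:
  fixes n m :: "real^2"
  assumes n: "norm n = 1" and nm: "m = vector [- n $ 2, n $ 1]"
    and T_def: "T = (\<lambda>y::real^2. y $ 1 *\<^sub>R n + y $ 2 *\<^sub>R m)"
  shows "orthogonal_transformation T" "T y \<bullet> n = y $ 1" "T y \<bullet> m = y $ 2"
    "T (vector [x \<bullet> n, x \<bullet> m]) = x"
proof -
  have unit: "n $ 1 * n $ 1 + n $ 2 * n $ 2 = 1"
    using n by (metis inner_vec2 norm_eq_1)
  have m_nth: "m $ 1 = - n $ 2" "m $ 2 = n $ 1" by (simp_all add: nm)
  have "linear T"
    unfolding T_def by (intro linearI) (simp_all add: algebra_simps)
  moreover have "T x \<bullet> T y = x \<bullet> y" for x y
    using unit unfolding T_def by (simp add: inner_vec2 m_nth) algebra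
  ultimately show "orthogonal_transformation T"
    by (simp add: orthogonal_transformation_def)
  show "T y \<bullet> n = y $ 1" "T y \<bullet> m = y $ 2" for y
    using unit unfolding T_def by (simp_all add: inner_vec2 m_nth) algebra+
  show "T (vector [x \<bullet> n, x \<bullet> m]) = x"
    using unit unfolding T_def by (simp add: vec_eq_iff forall_2 inner_vec2 m_nth) algebra
qed

lemma measure_rotated_box:
  fixes n m :: "real^2"
  assumes n: "norm n = 1" and m: "m = vector [- n $ 2, n $ 1]"
    and le: "p \<le> q" "r \<le> s"
  shows "measure lborel {x. x \<bullet> n \<in> {p..q} \<and> x \<bullet> m \<in> {r..s}} = (q - p) * (s - r)"
    and "measure lborel {x. x \<bullet> n \<in> {p<..<q} \<and> x \<bullet> m \<in> {r<..<s}} = (q - p) * (s - r)"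
    and "bounded {x. x \<bullet> n \<in> {p..q} \<and> x \<bullet> m \<in> {r..s}}"
proof -
  define T where "T = (\<lambda>y::real^2. y $ 1 *\<^sub>R n + y $ 2 *\<^sub>R m)"
  note T = orthonormal_frame_isometry[OF n m T_def]
  let ?a = "vector [p, r] :: real^2" and ?b = "vector [q, s] :: real^2"
  have img: "{x. x \<bullet> n \<in> {p..q} \<and> x \<bullet> m \<in> {r..s}} = T ` cbox ?a ?b" (is "?C = _")
    "{x. x \<bullet> n \<in> {p<..<q} \<and> x \<bullet> m \<in> {r<..<s}} = T ` box ?a ?b" (is "?O = _")
  proof -
    have "x \<in> T ` S" if "vector [x \<bullet> n, x \<bullet> m] \<in> S" for x S
      using that T(4)[of x] by (metis image_eqI)
    then show "?C = T ` cbox ?a ?b" "?O = T ` box ?a ?b"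
      by (auto simp: mem_box_cart forall_2 T(2,3))
  qed
  have cont: "measure lebesgue (cbox ?a ?b) = (q - p) * (s - r)"
  proof -
    have "cbox ?a ?b \<noteq> {}" using le by (auto simp: interval_ne_empty_cart forall_2)
    then show ?thesis
      by (simp add: content_cbox_cart prod_2 UNIV_2)
  qed
  have meas: "measure lborel A = measure lebesgue A" if "A \<in> sets borel" for A :: "(real^2) set"
    using that by simp
  have "closed ?C"
    by (simp add: Collect_conj_eq closed_Collect_conj closed_Collect_le continuous_intros)
  then have "measure lborel ?C = measure lebesgue ?C" by simp
  then show "measure lborel ?C = (q - p) * (s - r)"
    unfolding img(1) using measure_orthogonal_image[OF T(1), of "cbox ?a ?b"] cont by simp
  have "open ?O"
    by (simp add: open_Collect_conj open_Collect_less continuous_intros)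
  then have "measure lborel ?O = measure lebesgue ?O" by simp
  moreover have "measure lebesgue (box ?a ?b) = measure lebesgue (cbox ?a ?b)"
    by (simp add: measure_def emeasure_lborel_box_eq emeasure_lborel_cbox_eq)
  ultimately show "measure lborel ?O = (q - p) * (s - r)"
    unfolding img(2) using measure_orthogonal_image[OF T(1), of "box ?a ?b"] cont by simp
  show "bounded ?C"
    unfolding img(1) using T(1)
    by (intro bounded_linear_image) (auto simp: orthogonal_transformation_linear linear_linear)
qed

text \<open>Both matrices share the left factor \<open>a\<close>, so their mixed second-order term in the determinant is zero.\<close>

lemma det_add_tensors:
  "det (G + \<alpha> *\<^sub>R tensor a n + \<gamma> *\<^sub>R tensor a m)
     = det (G + \<alpha> *\<^sub>R tensor a n) + \<gamma> * (det (G + tensor a m) - det G)"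
  by (simp add: det_2 tensor_nth algebra_simps)

lemma det_tensor: "det (tensor a n) = 0"
  by (simp add: det_2 tensor_nth)

text \<open>The segment from \<open>F\<close> to \<open>F + tensor a n\<close> stays in \<open>GL\<^sup>+(2)\<close> because the determinant is affine on it, and
  perturbations in the direction \<open>tensor a m\<close> change the determinant by a fixed multiple of their size.
  The parameters are measured from the point \<open>F + t * tensor a n\<close>.\<close>

lemma laminate_neighbourhood_compact:
  assumes F: "F \<in> GLp" and FH: "F + tensor a n \<in> GLp" and t: "0 < t" "t < 1"
  obtains e where "e > 0"
    "compact ((\<lambda>(\<alpha>, \<gamma>). F + t *\<^sub>R tensor a n + \<alpha> *\<^sub>R tensor a n + \<gamma> *\<^sub>R tensor a m)
       ` ({- t..1 - t} \<times> {- e..e}))"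
    "(\<lambda>(\<alpha>, \<gamma>). F + t *\<^sub>R tensor a n + \<alpha> *\<^sub>R tensor a n + \<gamma> *\<^sub>R tensor a m)
       ` ({- t..1 - t} \<times> {- e..e}) \<subseteq> GLp"
proof -
  define G where "G = F + t *\<^sub>R tensor a n"
  define \<kappa> where "\<kappa> = det (G + tensor a m) - det G"
  define d where "d = min (det F) (det (F + tensor a n))"
  have "d > 0" using F FH by (simp add: d_def GLp_def)
  have line: "d \<le> det (G + \<alpha> *\<^sub>R tensor a n)" if "- t \<le> \<alpha>" "\<alpha> \<le> 1 - t" for \<alpha>
  proof -
    have "det (G + \<alpha> *\<^sub>R tensor a n)
        = (1 - (t + \<alpha>)) * det F + (t + \<alpha>) * det (F + tensor a n)"
      using det_add_singular[OF det_tensor, of F "t + \<alpha>" a n]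
      by (simp add: G_def algebra_simps)
    moreover have "(1 - (t + \<alpha>)) * d \<le> (1 - (t + \<alpha>)) * det F"
      using that by (intro mult_left_mono) (auto simp: d_def)
    moreover have "(t + \<alpha>) * d \<le> (t + \<alpha>) * det (F + tensor a n)"
      using that by (intro mult_left_mono) (auto simp: d_def)
    ultimately show ?thesis by (simp add: left_diff_distrib)
  qed
  define e where "e = d / (2 * (\<bar>\<kappa>\<bar> + 1))"
  have "e > 0" using \<open>d > 0\<close> by (simp add: e_def)
  have "e * \<bar>\<kappa>\<bar> < d"
  proof -
    have "e * \<bar>\<kappa>\<bar> < e * (2 * (\<bar>\<kappa>\<bar> + 1))"
      using \<open>e > 0\<close> by (intro mult_strict_left_mono) auto
    also have "\<dots> = d" by (simp add: e_def)
    finally show ?thesis .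
  qed
  have "det (G + \<alpha> *\<^sub>R tensor a n + \<gamma> *\<^sub>R tensor a m) > 0"
    if "- t \<le> \<alpha>" "\<alpha> \<le> 1 - t" "- e \<le> \<gamma>" "\<gamma> \<le> e" for \<alpha> \<gamma>
  proof -
    have "\<bar>\<gamma> * \<kappa>\<bar> \<le> e * \<bar>\<kappa>\<bar>"
      unfolding abs_mult using that by (intro mult_right_mono) auto
    then show ?thesis
      using line[OF that(1,2)] \<open>e * \<bar>\<kappa>\<bar> < d\<close>
      unfolding det_add_tensors \<kappa>_def[symmetric] by linarith
  qed
  then have "(\<lambda>(\<alpha>, \<gamma>). F + t *\<^sub>R tensor a n + \<alpha> *\<^sub>R tensor a n + \<gamma> *\<^sub>R tensor a m)
       ` ({- t..1 - t} \<times> {- e..e}) \<subseteq> GLp"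
    by (auto simp: GLp_def G_def)
  moreover have "compact ((\<lambda>(\<alpha>, \<gamma>). F + t *\<^sub>R tensor a n + \<alpha> *\<^sub>R tensor a n + \<gamma> *\<^sub>R tensor a m)
       ` ({- t..1 - t} \<times> {- e..e}))"
    unfolding case_prod_beta
    by (intro compact_continuous_image continuous_intros compact_Times) auto
  ultimately show ?thesis
    using \<open>e > 0\<close> that by blast
qed

lemma laminate_test_function:
  fixes f f' g g' :: "real \<Rightarrow> real" and n m a :: "real^2"
  assumes n: "norm n = 1" and m: "m = vector [- n $ 2, n $ 1]"
    and f: "\<And>k. times_cont_diff k f" "\<And>x. (f has_field_derivative f' x) (at x)"
    and g: "\<And>k. times_cont_diff k g" "\<And>x. (g has_field_derivative g' x) (at x)"
    and supp: "p \<le> q" "r \<le> s" "\<And>x. x \<notin> {p..q} \<Longrightarrow> f x = 0" "\<And>x. x \<notin> {r..s} \<Longrightarrow> g x = 0"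
      "{x. x \<bullet> n \<in> {p..q} \<and> x \<bullet> m \<in> {r..s}} \<subseteq> \<Omega>"
  defines "\<theta> \<equiv> \<lambda>x. (f (x \<bullet> n) * g (x \<bullet> m)) *\<^sub>R a"
  shows "test_function \<Omega> \<theta>"
    and "jacobian \<theta> (at x) = (f' (x \<bullet> n) * g (x \<bullet> m)) *\<^sub>R tensor a n
                             + (f (x \<bullet> n) * g' (x \<bullet> m)) *\<^sub>R tensor a m"
proof -
  let ?C = "{x. x \<bullet> n \<in> {p..q} \<and> x \<bullet> m \<in> {r..s}}"
  have "times_cont_diff k (\<lambda>x. f (x \<bullet> n + 0) * g (x \<bullet> m + 0))" for k
    by (intro times_cont_diff_mult times_cont_diff_compose_affine f g bounded_linear_inner_left)
  then have smooth: "times_cont_diff k \<theta>" for k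
    unfolding \<theta>_def
    using times_cont_diff_bounded_linear[OF bounded_linear_scaleR_left] by force
  have "support_on UNIV \<theta> \<subseteq> ?C"
    using supp(3,4) by (auto simp: support_on_def \<theta>_def)
  moreover have C: "closed ?C"
    by (simp add: Collect_conj_eq closed_Collect_conj closed_Collect_le continuous_intros)
  ultimately have sub: "closure (support_on UNIV \<theta>) \<subseteq> ?C"
    by (intro closure_minimal)
  then have "bounded (closure (support_on UNIV \<theta>))"
    using measure_rotated_box(3)[OF n m supp(1,2)] by (rule bounded_subset[rotated])
  then have "compact (closure (support_on UNIV \<theta>))"
    by (simp add: compact_eq_bounded_closed)
  then show "test_function \<Omega> \<theta>"
    unfolding test_function_def using smooth sub supp(5) by auto
  have "((\<lambda>x. f (x \<bullet> n)) has_derivative (\<lambda>v. f' (x \<bullet> n) * (v \<bullet> n))) (at x)"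
    by (rule has_derivative_compose[OF _ f(2)[unfolded has_field_derivative_def]])
      (auto intro!: derivative_eq_intros)
  moreover have "((\<lambda>x. g (x \<bullet> m)) has_derivative (\<lambda>v. g' (x \<bullet> m) * (v \<bullet> m))) (at x)"
    by (rule has_derivative_compose[OF _ g(2)[unfolded has_field_derivative_def]])
      (auto intro!: derivative_eq_intros)
  ultimately have "(\<theta> has_derivative
      (\<lambda>v. (f (x \<bullet> n) * (g' (x \<bullet> m) * (v \<bullet> m)) + f' (x \<bullet> n) * (v \<bullet> n) * g (x \<bullet> m)) *\<^sub>R a)) (at x)"
    unfolding \<theta>_def
    by (intro bounded_linear.has_derivative[OF bounded_linear_scaleR_left] has_derivative_mult)
  then have "frechet_derivative \<theta> (at x) =
      (\<lambda>v. (f (x \<bullet> n) * (g' (x \<bullet> m) * (v \<bullet> m)) + f' (x \<bullet> n) * (v \<bullet> n) * g (x \<bullet> m)) *\<^sub>R a)"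
    by (rule frechet_derivative_at[symmetric])
  then show "jacobian \<theta> (at x) = (f' (x \<bullet> n) * g (x \<bullet> m)) *\<^sub>R tensor a n
                             + (f (x \<bullet> n) * g' (x \<bullet> m)) *\<^sub>R tensor a m"
    by (simp add: vec_eq_iff jacobian_nth tensor_nth inner_axis' algebra_simps)
qed

text \<open>Stretching a bump function to a sufficiently long interval makes its slope as small as required,
  while the proportion of the plateau is unchanged.\<close>

lemma ex_small_slope_cutoff:
  fixes d e :: real
  assumes d: "0 < d" and e: "0 < e"
  obtains L g g' where "L > 0" "\<And>k. times_cont_diff k g" "\<And>x. (g has_field_derivative g' x) (at x)"
    "\<And>x. 0 \<le> g x" "\<And>x. g x \<le> 1" "\<And>x. x \<notin> {d * L..L - d * L} \<Longrightarrow> g x = 0"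
    "\<And>x. x \<in> {2 * d * L..L - 2 * d * L} \<Longrightarrow> g x = 1" "\<And>x. \<bar>g' x\<bar> \<le> e"
proof -
  obtain B :: "real \<Rightarrow> real" where B: "\<And>k. times_cont_diff k B"
    "\<And>x. 0 \<le> B x" "\<And>x. B x \<le> 1" "\<And>x. x \<le> d \<or> 1 - d \<le> x \<Longrightarrow> B x = 0"
    "\<And>x. 2 * d \<le> x \<Longrightarrow> x \<le> 1 - 2 * d \<Longrightarrow> B x = 1"
    using ex_smooth_bump[OF d] by blast
  define B' where "B' x = frechet_derivative B (at x) 1" for x
  have dB: "(B has_field_derivative B' x) (at x)" for x
  proof -
    have *: "(B has_derivative frechet_derivative B (at x)) (at x)"
      using times_cont_diff_has_derivative[OF B(1)] .
    moreover have "frechet_derivative B (at x) = (*) (B' x)"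
    proof
      show "frechet_derivative B (at x) c = B' x * c" for c
        using linear_scale[OF has_derivative_linear[OF *], of c 1] by (simp add: B'_def)
    qed
    ultimately show ?thesis by (simp add: has_field_derivative_def)
  qed
  have "continuous_on {0..1} B'"
    using B(1)[of "Suc 0"] unfolding B'_def by (auto intro: continuous_on_subset)
  then have "bounded (B' ` {0..1})"
    by (intro compact_imp_bounded compact_continuous_image) auto
  then obtain M where M: "M > 0" "\<And>x. x \<in> {0..1} \<Longrightarrow> \<bar>B' x\<bar> \<le> M"
    unfolding bounded_pos by auto
  have M': "\<bar>B' x\<bar> \<le> M" for x
  proof (cases "x \<in> {0..1}")
    case False
    have "((\<lambda>_. 0) has_field_derivative 0) (at x)" by simp
    then have "(B has_field_derivative 0) (at x)"
      by (rule has_field_derivative_transform_within_open[of _ _ _ "- {0..1}"])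
        (use False d B(4) in \<open>force+\<close>)
    with dB have "B' x = 0" by (rule DERIV_unique)
    with M show ?thesis by simp
  qed (use M in auto)
  define L where "L = M / e"
  have "L > 0" using M e by (simp add: L_def)
  show ?thesis
  proof (rule that[of L "\<lambda>x. B (x / L + 0)" "\<lambda>x. B' (x / L) / L"])
    show "times_cont_diff k (\<lambda>x. B (x / L + 0))" for k
      by (intro times_cont_diff_compose_affine bounded_linear_divide B)
    show "((\<lambda>x. B (x / L + 0)) has_field_derivative B' (x / L) / L) (at x)" for x
    proof -
      have "((\<lambda>x. x / L) has_field_derivative 1 / L) (at x)"
        using \<open>L > 0\<close> by (auto intro!: derivative_eq_intros)
      from DERIV_chain2[OF dB this] show ?thesis by simp
    qed
    show "B (x / L + 0) = 0" if "x \<notin> {d * L..L - d * L}" for x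
    proof -
      have "x < d * L \<or> (1 - d) * L < x" using that by (auto simp: left_diff_distrib)
      then have "x / L \<le> d \<or> 1 - d \<le> x / L"
        using \<open>L > 0\<close> by (auto simp: divide_le_eq le_divide_eq)
      then show ?thesis using B(4) by simp
    qed
    show "B (x / L + 0) = 1" if "x \<in> {2 * d * L..L - 2 * d * L}" for x
    proof -
      have "2 * d * L \<le> x" "x \<le> (1 - 2 * d) * L" using that by (auto simp: left_diff_distrib)
      then have "2 * d \<le> x / L" "x / L \<le> 1 - 2 * d"
        using \<open>L > 0\<close> by (simp_all add: divide_le_eq le_divide_eq)
      then show ?thesis using B(5) by simp
    qed
    show "\<bar>B' (x / L) / L\<bar> \<le> e" for x
    proof -
      have "\<bar>B' (x / L)\<bar> \<le> e * L" using M'[of "x / L"] e by (simp add: L_def)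
      then show ?thesis using \<open>L > 0\<close> by (simp add: divide_le_eq)
    qed
  qed (use B \<open>L > 0\<close> in auto)
qed

text \<open>Test quasiconvexity at \<open>G = F + t * tensor a n\<close> on a \<open>1 \<times> L\<close> rectangle with sides along \<open>n\<close> and \<open>m\<close>, using a
  tent in the direction \<open>n\<close> times a long cutoff in the direction \<open>m\<close>. The gradient field takes the
  value \<open>F + tensor a n\<close> on a proportion \<open>t (1 - 4d)\<^sup>2\<close> of the rectangle and \<open>F\<close> on a proportion
  \<open>(1 - t) (1 - 4d)\<^sup>2\<close>. Elsewhere it stays in \<open>K\<close>, where \<open>w\<close> is at most \<open>M\<close>.\<close>

lemma quasiconvex_laminate_estimate:
  assumes qc: "quasiconvex w"
    and F: "F \<in> GLp" and FH: "F + tensor a n \<in> GLp" and t: "0 < t" "t < 1"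
    and n: "norm n = 1" and m: "m = vector [- n $ 2, n $ 1]"
    and K: "e > 0" "K = (\<lambda>(\<alpha>, \<gamma>). F + t *\<^sub>R tensor a n + \<alpha> *\<^sub>R tensor a n + \<gamma> *\<^sub>R tensor a m)
       ` ({- t..1 - t} \<times> {- e..e})" "K \<subseteq> GLp"
    and M: "\<And>X. X \<in> K \<Longrightarrow> w X \<le> M"
    and d: "0 < d" "d < 1/4"
  shows "w (F + t *\<^sub>R tensor a n) \<le>
    M + (t * (w (F + tensor a n) - M) + (1 - t) * (w F - M)) * (1 - 4 * d)\<^sup>2"
proof -
  define G where "G = F + t *\<^sub>R tensor a n"
  obtain f f' c where f: "\<And>k. times_cont_diff k f" "\<And>x. (f has_field_derivative f' x) (at x)"
    "0 < c" "\<And>x. x < c \<or> 1 - c < x \<Longrightarrow> f x = 0"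
    "\<And>x. \<bar>f x\<bar> \<le> 1" "\<And>x. - t \<le> f' x" "\<And>x. f' x \<le> 1 - t"
    "\<And>x. 2 * d * t \<le> x \<Longrightarrow> x \<le> (1 - 2 * d) * t \<Longrightarrow> f' x = 1 - t"
    "\<And>x. t + 2 * d * (1 - t) \<le> x \<Longrightarrow> x \<le> t + (1 - 2 * d) * (1 - t) \<Longrightarrow> f' x = - t"
    using ex_laminate_profile[OF t d] by blast
  \<comment> \<open>Otherwise the tent would be identically zero, contradicting its slope \<open>1 - t\<close>.\<close>
  have c: "c \<le> 1 - c"
  proof (rule ccontr)
    assume "\<not> c \<le> 1 - c"
    then have "f x = 0" for x using f(4)[of x] by linarith
    then have "f = (\<lambda>x. 0)" by (simp add: fun_eq_iff)
    then have "((\<lambda>x. 0) has_field_derivative f' (2 * d * t)) (at (2 * d * t))"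
      using f(2)[of "2 * d * t"] by simp
    then have "f' (2 * d * t) = 0"
      using DERIV_const by (rule DERIV_unique)
    moreover have "2 * d * t \<le> (1 - 2 * d) * t" using d t by (intro mult_right_mono) auto
    ultimately show False using f(8)[of "2 * d * t"] t by simp
  qed
  obtain L g g' where g: "L > 0" "\<And>k. times_cont_diff k g" "\<And>x. (g has_field_derivative g' x) (at x)"
    "\<And>x. 0 \<le> g x" "\<And>x. g x \<le> 1" "\<And>x. x \<notin> {d * L..L - d * L} \<Longrightarrow> g x = 0"
    "\<And>x. x \<in> {2 * d * L..L - 2 * d * L} \<Longrightarrow> g x = 1" "\<And>x. \<bar>g' x\<bar> \<le> e"
    using ex_small_slope_cutoff[OF d(1) K(1)] by blast
  \<comment> \<open>On its plateau the cutoff attains its maximum.\<close>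
  have g'0: "g' y = 0" if "g y = 1" for y
    by (rule DERIV_local_max[OF g(3), of 1]) (use that g(5) in auto)
  have dL: "d * L \<le> L - d * L" "0 < d * L" "2 * d * L \<le> L - 2 * d * L"
  proof -
    have "d * L < 1 / 4 * L" using d g(1) by (intro mult_strict_right_mono)
    then show "d * L \<le> L - d * L" "0 < d * L" "2 * d * L \<le> L - 2 * d * L"
      using d g(1) by auto
  qed
  define R where "R p q r s = {x. x \<bullet> n \<in> {p..q} \<and> x \<bullet> m \<in> {r..s}}" for p q r s
  define \<Omega> where "\<Omega> = {x. x \<bullet> n \<in> {0<..<1} \<and> x \<bullet> m \<in> {0<..<L}}"
  have R: "measure lborel (R p q r s) = (q - p) * (s - r)" "bounded (R p q r s)" "closed (R p q r s)"
    if "p \<le> q" "r \<le> s" for p q r s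
  proof -
    show "measure lborel (R p q r s) = (q - p) * (s - r)" "bounded (R p q r s)"
      unfolding R_def using measure_rotated_box[OF n m that] by auto
    show "closed (R p q r s)"
      unfolding R_def
      by (simp add: Collect_conj_eq closed_Collect_conj closed_Collect_le continuous_intros)
  qed
  have \<Omega>_open: "open \<Omega>"
    unfolding \<Omega>_def by (simp add: open_Collect_conj open_Collect_less continuous_intros)
  have \<Omega>_bounded: "bounded \<Omega>"
    by (rule bounded_subset[OF R(2)[of 0 1 0 L]]) (use g(1) in \<open>auto simp: R_def \<Omega>_def\<close>)
  have \<Omega>_measure: "measure lborel \<Omega> = L"
    unfolding \<Omega>_def using measure_rotated_box(2)[OF n m, of 0 1 0 L] g(1) by simp
  define \<theta> where "\<theta> = (\<lambda>x. (f (x \<bullet> n) * g (x \<bullet> m)) *\<^sub>R a)"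
  have sub: "{x. x \<bullet> n \<in> {c..1 - c} \<and> x \<bullet> m \<in> {d * L..L - d * L}} \<subseteq> \<Omega>"
    using f(3) dL by (auto simp: \<Omega>_def)
  have f0: "f x = 0" if "x \<notin> {c..1 - c}" for x using that f(4) by auto
  note lam = laminate_test_function[OF n m f(1,2) g(2,3) c dL(1) f0 g(6) sub]
  have test: "test_function \<Omega> \<theta>"
    unfolding \<theta>_def by (rule lam(1))
  have jac: "jacobian \<theta> (at x) = (f' (x \<bullet> n) * g (x \<bullet> m)) *\<^sub>R tensor a n
      + (f (x \<bullet> n) * g' (x \<bullet> m)) *\<^sub>R tensor a m" for x
    unfolding \<theta>_def by (rule lam(2))
  have in_K: "G + jacobian \<theta> (at x) \<in> K" for x
  proof -
    have "- t \<le> f' (x \<bullet> n) * g (x \<bullet> m)" "f' (x \<bullet> n) * g (x \<bullet> m) \<le> 1 - t"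
    proof -
      have "f' y * g z \<le> 1 - t" "- t \<le> f' y * g z" for y z
      proof -
        have "f' y * g z \<le> (1 - t) * g z" "(- t) * g z \<le> f' y * g z"
          using f(6,7) g(4) by (blast intro: mult_right_mono)+
        moreover have "(1 - t) * g z \<le> 1 - t" "t * g z \<le> t"
          using t g(4,5) by (auto simp: mult_left_le)
        ultimately show "f' y * g z \<le> 1 - t" "- t \<le> f' y * g z" by linarith+
      qed
      then show "- t \<le> f' (x \<bullet> n) * g (x \<bullet> m)" "f' (x \<bullet> n) * g (x \<bullet> m) \<le> 1 - t" by auto
    qed
    moreover have "\<bar>f (x \<bullet> n) * g' (x \<bullet> m)\<bar> \<le> 1 * e"
      unfolding abs_mult using f(5) g(8) by (intro mult_mono) auto
    ultimately show ?thesis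
      unfolding jac K(2) G_def
      by (intro image_eqI[of _ _ "(f' (x \<bullet> n) * g (x \<bullet> m), f (x \<bullet> n) * g' (x \<bullet> m))"]) auto
  qed
  define E1 where "E1 = R (2 * d * t) ((1 - 2 * d) * t) (2 * d * L) (L - 2 * d * L)"
  define E2 where "E2 = R (t + 2 * d * (1 - t)) (t + (1 - 2 * d) * (1 - t)) (2 * d * L) (L - 2 * d * L)"
  have le1: "2 * d * t \<le> (1 - 2 * d) * t" and le2: "t + 2 * d * (1 - t) \<le> t + (1 - 2 * d) * (1 - t)"
    using d t by (auto intro: mult_right_mono)
  have E1: "measure lborel E1 = t * (1 - 4 * d)\<^sup>2 * L" "bounded E1" "closed E1"
    unfolding E1_def using R[OF le1 dL(3)] by (auto simp: power2_eq_square algebra_simps)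
  have E2: "measure lborel E2 = (1 - t) * (1 - 4 * d)\<^sup>2 * L" "bounded E2" "closed E2"
    unfolding E2_def using R[OF le2 dL(3)] by (auto simp: power2_eq_square algebra_simps)
  have w_E1: "w (G + jacobian \<theta> (at x)) = w (F + tensor a n)" if "x \<in> E1" for x
  proof -
    have g1: "g (x \<bullet> m) = 1" and f1: "f' (x \<bullet> n) = 1 - t"
      using that f(8) g(7) by (auto simp: E1_def R_def)
    have "g' (x \<bullet> m) = 0"
      using g1 by (rule g'0)
    then show ?thesis
      unfolding jac by (simp add: f1 g1 G_def algebra_simps)
  qed
  have w_E2: "w (G + jacobian \<theta> (at x)) = w F" if "x \<in> E2" for x
  proof -
    have g1: "g (x \<bullet> m) = 1" and f1: "f' (x \<bullet> n) = - t"
      using that f(9) g(7) by (auto simp: E2_def R_def)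
    have "g' (x \<bullet> m) = 0"
      using g1 by (rule g'0)
    then show ?thesis
      unfolding jac by (simp add: f1 g1 G_def algebra_simps)
  qed
  have "E1 \<inter> E2 = {}"
  proof -
    have "(1 - 2 * d) * t < t + 2 * d * (1 - t)"
      using d t by (simp add: left_diff_distrib right_diff_distrib)
    then show ?thesis by (auto simp: E1_def E2_def R_def)
  qed
  have sub: "E1 \<subseteq> \<Omega>" "E2 \<subseteq> \<Omega>"
  proof -
    have pos: "0 < 2 * d * t" "0 < 2 * d * (1 - t)" "0 < 2 * d * L" using d t g(1) by simp_all
    have less: "(1 - 2 * d) * t < 1 * t" "(1 - 2 * d) * (1 - t) < 1 * (1 - t)"
      using d t by (intro mult_strict_right_mono; simp)+
    have "x \<in> \<Omega>" if "x \<in> E1" for x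
      using that pos less t unfolding E1_def R_def \<Omega>_def mem_Collect_eq
        atLeastAtMost_iff greaterThanLessThan_iff by linarith
    moreover have "x \<in> \<Omega>" if "x \<in> E2" for x
    proof -
      have x: "t + 2 * d * (1 - t) \<le> x \<bullet> n" "x \<bullet> n \<le> t + (1 - 2 * d) * (1 - t)"
        "2 * d * L \<le> x \<bullet> m" "x \<bullet> m \<le> L - 2 * d * L"
        using that by (auto simp: E2_def R_def)
      have "0 < t + 2 * d * (1 - t)" using t pos(2) by (intro add_pos_pos)
      moreover have "t + (1 - 2 * d) * (1 - t) < t + 1 * (1 - t)"
        using less(2) by (intro add_strict_left_mono)
      ultimately have "0 < x \<bullet> n" "x \<bullet> n < 1"
        using x(1,2) by (auto intro: less_le_trans le_less_trans)
      moreover have "0 < x \<bullet> m" using x(3) pos(3) by linarith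
      moreover have "x \<bullet> m < L" using x(4) pos(3) by linarith
      ultimately show ?thesis by (simp add: \<Omega>_def)
    qed
    ultimately show "E1 \<subseteq> \<Omega>" "E2 \<subseteq> \<Omega>" by auto
  qed
  define u where "u x = M * indicator \<Omega> x + (w (F + tensor a n) - M) * indicator E1 x
      + (w F - M) * indicator E2 x" for x
  have fin: "emeasure lborel A < \<infinity>" if "bounded A" for A :: "(real^2) set"
    using that by (rule emeasure_bounded_finite)
  have ind: "integrable lborel (indicator A :: real^2 \<Rightarrow> real)" if "A \<in> sets borel" "bounded A" for A
    using that fin by (intro integrable_real_indicator) auto
  have inds: "integrable lborel (indicator \<Omega> :: real^2 \<Rightarrow> real)"
    "integrable lborel (indicator E1 :: real^2 \<Rightarrow> real)"
    "integrable lborel (indicator E2 :: real^2 \<Rightarrow> real)"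
    using E1 E2 \<Omega>_open \<Omega>_bounded by (auto intro!: ind)
  have int_u: "integrable lborel u"
    unfolding u_def using inds by auto
  have meas: "w \<in> borel_measurable (restrict_space borel GLp)"
    and lb: "\<And>K. compact K \<Longrightarrow> K \<subseteq> GLp \<Longrightarrow> bounded (w ` K)"
    and ineq: "\<And>F0 \<Omega> \<theta>. F0 \<in> GLp \<Longrightarrow> open \<Omega> \<Longrightarrow> bounded \<Omega> \<Longrightarrow> test_function \<Omega> \<theta> \<Longrightarrow>
        (\<forall>x\<in>\<Omega>. F0 + jacobian \<theta> (at x) \<in> GLp) \<Longrightarrow>
        w F0 * measure lborel \<Omega> \<le> (LINT x:\<Omega>|lborel. w (F0 + jacobian \<theta> (at x)))"
    using qc unfolding quasiconvex_def by blast+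
  have "G \<in> K"
    unfolding K(2) G_def using t K(1) by (intro image_eqI[of _ _ "(0, 0)"]) auto
  then have G: "G \<in> GLp" using K(3) by auto
  have pos: "\<And>x. x \<in> \<Omega> \<Longrightarrow> G + jacobian \<theta> (at x) \<in> GLp" using in_K K(3) by auto
  have "w G * L \<le> (LINT x:\<Omega>|lborel. w (G + jacobian \<theta> (at x)))"
    using ineq[OF G \<Omega>_open \<Omega>_bounded test] pos \<Omega>_measure by simp
  also have "\<dots> \<le> (LINT x|lborel. u x)"
    unfolding set_lebesgue_integral_def
  proof (rule integral_mono)
    show "integrable lborel (\<lambda>x. indicator \<Omega> x *\<^sub>R w (G + jacobian \<theta> (at x)))"
      using set_integrable_compose_jacobian[OF meas lb G \<Omega>_open \<Omega>_bounded test pos]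
      by (simp add: set_integrable_def)
    show "integrable lborel u" by (rule int_u)
    show "indicator \<Omega> x *\<^sub>R w (G + jacobian \<theta> (at x)) \<le> u x" for x
      using M[OF in_K, of x] w_E1[of x] w_E2[of x] \<open>E1 \<inter> E2 = {}\<close> sub
      by (auto simp: u_def indicator_def)
  qed
  also have "\<dots> = M * L + (w (F + tensor a n) - M) * (t * (1 - 4 * d)\<^sup>2 * L)
      + (w F - M) * ((1 - t) * (1 - 4 * d)\<^sup>2 * L)"
    unfolding u_def using inds E1(1) E2(1) \<Omega>_measure by simp
  also have "\<dots> = (M + (t * (w (F + tensor a n) - M) + (1 - t) * (w F - M)) * (1 - 4 * d)\<^sup>2) * L"
    by (simp add: algebra_simps)
  finally show ?thesis
    using g(1) by (simp add: G_def)
qed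

text \<open>The compact set of admissible gradients, and with it the bound \<open>M\<close>, is chosen before the loss \<open>d\<close> in
  the laminate estimate, so \<open>d\<close> can tend to zero.\<close>

lemma rank_one_convex_if_quasiconvex:
  assumes qc: "quasiconvex w" shows "rank_one_convex w"
  unfolding rank_one_convex_def
proof (intro ballI allI impI)
  fix F H :: "real^2^2" and t :: real
  assume F: "F \<in> GLp" and t01: "t \<in> {0..1}" and rank: "rank H = 1" and FH: "F + H \<in> GLp"
  consider "t = 0" | "t = 1" | "0 < t" "t < 1" using t01 by force
  then show "w ((1 - t) *\<^sub>R F + t *\<^sub>R (F + H)) \<le> (1 - t) * w F + t * w (F + H)"
  proof cases
    case 3
    obtain a n where n: "norm n = 1" and H: "H = tensor a n"
      using singular_eq_tensor rank rank_one_iff_2x2 by metis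
    define m :: "real^2" where "m = vector [- n $ 2, n $ 1]"
    define X where "X = (\<lambda>(\<alpha>, \<gamma>). F + t *\<^sub>R tensor a n + \<alpha> *\<^sub>R tensor a n + \<gamma> *\<^sub>R tensor a m)"
    obtain e where e: "e > 0" "compact (X ` ({- t..1 - t} \<times> {- e..e}))" "X ` ({- t..1 - t} \<times> {- e..e}) \<subseteq> GLp"
      using laminate_neighbourhood_compact[OF F FH[unfolded H] 3, of m] unfolding X_def by blast
    then have "bounded (w ` X ` ({- t..1 - t} \<times> {- e..e}))"
      using qc unfolding quasiconvex_def by blast
    then obtain M where M: "\<And>Y. Y \<in> X ` ({- t..1 - t} \<times> {- e..e}) \<Longrightarrow> w Y \<le> M"
      unfolding bounded_iff by (metis abs_le_D1 imageI real_norm_def)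
    define r where "r d = M + (t * (w (F + H) - M) + (1 - t) * (w F - M)) * (1 - 4 * d)\<^sup>2" for d
    have "w (F + t *\<^sub>R H) \<le> r d" if "0 < d" "d < 1/4" for d
      unfolding r_def H
      by (rule quasiconvex_laminate_estimate[OF qc F FH[unfolded H] 3 n m_def e(1) X_def[THEN arg_cong] e(3) M that])
    then have "\<forall>\<^sub>F d in at_right 0. w (F + t *\<^sub>R H) \<le> r d"
      by (auto simp: eventually_at_right_field intro!: exI[of _ "1/4"])
    moreover have "(r \<longlongrightarrow> r 0) (at_right 0)"
      unfolding r_def by (auto intro!: tendsto_eq_intros)
    ultimately have "w (F + t *\<^sub>R H) \<le> r 0"
      by (intro tendsto_lowerbound[of r _ "at_right 0"]) auto
    then show ?thesis
      by (simp add: r_def algebra_simps)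
  qed auto
qed


section \<open>Conformal symmetrisation and the envelopes\<close>

definition stretch :: "real \<Rightarrow> real^2^2" where
  "stretch t = vector [vector [t, 0], vector [0, 1]]"

definition rot :: "real \<Rightarrow> real^2^2" where
  "rot x = vector [vector [cos x, - sin x], vector [sin x, cos x]]"

lemma stretch_nth [simp]:
  "stretch t $ 1 $ 1 = t" "stretch t $ 1 $ 2 = 0" "stretch t $ 2 $ 1 = 0" "stretch t $ 2 $ 2 = 1"
  by (simp_all add: stretch_def)

lemma rot_nth [simp]:
  "rot x $ 1 $ 1 = cos x" "rot x $ 1 $ 2 = - sin x" "rot x $ 2 $ 1 = sin x" "rot x $ 2 $ 2 = cos x"
  by (simp_all add: rot_def)

lemma rotation_matrix_rot: "rotation_matrix (rot x)"
  by (simp add: rotation_matrix_def orthogonal_matrix mat2 mat_def det_2 flip: power2_eq_square)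

lemma scaleR_rot_in_CSO2: "c > 0 \<Longrightarrow> c *\<^sub>R rot x \<in> CSO2"
  using rotation_matrix_rot by (auto simp: CSO2_def)

lemma rot_in_CSO2: "rot x \<in> CSO2"
  using scaleR_rot_in_CSO2[of 1 x] by simp

lemma mat_1_in_CSO2: "mat 1 \<in> CSO2"
proof -
  have "rot 0 = mat 1" by (simp add: vec_eq_iff forall_2 mat_def)
  then show ?thesis using rot_in_CSO2 by metis
qed

lemma CSO2_mult: "A \<in> CSO2 \<Longrightarrow> B \<in> CSO2 \<Longrightarrow> A ** B \<in> CSO2"
proof -
  assume "A \<in> CSO2" "B \<in> CSO2"
  then obtain a b P Q where "A = a *\<^sub>R P" "B = b *\<^sub>R Q" "a > 0" "b > 0"
    and R: "rotation_matrix P" "rotation_matrix Q"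
    unfolding CSO2_def by blast
  then have "A ** B = (a * b) *\<^sub>R (P ** Q)"
    by (simp add: mat2 algebra_simps)
  moreover have "rotation_matrix (P ** Q)"
    using R by (simp add: rotation_matrix_def orthogonal_matrix_mul det_mul)
  moreover have "a * b > 0" using \<open>a > 0\<close> \<open>b > 0\<close> by simp
  ultimately show ?thesis unfolding CSO2_def by blast
qed

lemma CSO2_subset_GLp: "A \<in> CSO2 \<Longrightarrow> A \<in> GLp"
proof -
  have "det (a *\<^sub>R R) = a\<^sup>2 * det R" for a and R :: "real^2^2"
    by (simp add: det_2 power2_eq_square algebra_simps)
  then show "A \<in> CSO2 \<Longrightarrow> A \<in> GLp"
    by (auto simp: CSO2_def GLp_def rotation_matrix_def)
qed

lemma GLp_mult: "A \<in> GLp \<Longrightarrow> B \<in> GLp \<Longrightarrow> A ** B \<in> GLp"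
  by (simp add: GLp_def det_mul)

lemma stretch_in_GLp: "t > 0 \<Longrightarrow> stretch t \<in> GLp"
  by (simp add: GLp_def det_2)

lemma conformal_stretch_in_GLp:
  "t > 0 \<Longrightarrow> A \<in> CSO2 \<Longrightarrow> B \<in> CSO2 \<Longrightarrow> A ** stretch t ** B \<in> GLp"
  by (intro GLp_mult CSO2_subset_GLp stretch_in_GLp)

lemma distortion_stretch: "t \<ge> 1 \<Longrightarrow> distortion (stretch t) = t"
proof -
  assume t: "t \<ge> 1"
  have "conf_part (stretch t) = of_real ((t + 1) / 2)" "anti_part (stretch t) = of_real ((t - 1) / 2)"
    by (simp_all add: conf_part_def anti_part_def complex_eq_iff)
  then have norms: "cmod (conf_part (stretch t)) = (t + 1) / 2" "cmod (anti_part (stretch t)) = (t - 1) / 2"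
    using t by (simp_all only: norm_of_real) auto
  show ?thesis
    unfolding distortion_def norms by (simp add: field_simps)
qed

text \<open>In complex notation, \<open>F\<close> has conformal part \<open>\<alpha> e\<^sup>i\<^sup>\<phi>\<close> and anticonformal part \<open>\<beta> e\<^sup>i\<^sup>\<psi>\<close>. Rotating
  by \<open>y\<close> before and by \<open>x\<close> after \<open>diag (\<alpha> + \<beta>, \<alpha> - \<beta>)\<close> adds the phase \<open>x + y\<close> to the conformal part and
  \<open>x - y\<close> to the anticonformal part, so the angles can be solved for.\<close>

lemma conformal_decomposition:
  assumes F: "F \<in> GLp"
  obtains A B where "A \<in> CSO2" "B \<in> CSO2" "F = A ** stretch (distortion F) ** B"
proof -
  define \<alpha> \<beta> where "\<alpha> = cmod (conf_part F)" and "\<beta> = cmod (anti_part F)"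
  have ab: "\<beta> < \<alpha>" using F by (simp add: \<alpha>_def \<beta>_def GLp_iff_conf_anti)
  obtain \<phi> where \<phi>: "conf_part F = rcis \<alpha> \<phi>" unfolding \<alpha>_def by (metis rcis_cmod_Arg)
  obtain \<psi> where \<psi>: "anti_part F = rcis \<beta> \<psi>" unfolding \<beta>_def by (metis rcis_cmod_Arg)
  define x y where "x = (\<phi> + \<psi>) / 2" and "y = (\<phi> - \<psi>) / 2"
  have xy: "\<phi> = x + y" "\<psi> = x - y" by (simp_all add: x_def y_def field_simps)
  have "Re (conf_part F) = \<alpha> * cos \<phi>" "Im (conf_part F) = \<alpha> * sin \<phi>"
    "Re (anti_part F) = \<beta> * cos \<psi>" "Im (anti_part F) = \<beta> * sin \<psi>"
    by (simp_all add: \<phi> \<psi>)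
  then have entries: "F$1$1 = \<alpha> * cos \<phi> + \<beta> * cos \<psi>" "F$1$2 = \<beta> * sin \<psi> - \<alpha> * sin \<phi>"
    "F$2$1 = \<alpha> * sin \<phi> + \<beta> * sin \<psi>" "F$2$2 = \<alpha> * cos \<phi> - \<beta> * cos \<psi>"
    by (simp_all add: conf_part_def anti_part_def field_simps)
  have K: "(\<alpha> - \<beta>) * distortion F = \<alpha> + \<beta>"
    using ab by (simp add: distortion_def \<alpha>_def \<beta>_def)
  have "F = ((\<alpha> - \<beta>) *\<^sub>R rot x) ** stretch (distortion F) ** rot y"
  proof -
    have M: "(\<alpha> - \<beta>) *\<^sub>R rot x ** stretch (distortion F)
        = vector [vector [(\<alpha> + \<beta>) * cos x, - (\<alpha> - \<beta>) * sin x],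
                  vector [(\<alpha> + \<beta>) * sin x, (\<alpha> - \<beta>) * cos x]]"
      by (simp add: mat2 K[symmetric] algebra_simps)
    show ?thesis
      unfolding M by (simp add: mat2 entries xy cos_add cos_diff sin_add sin_diff algebra_simps)
  qed
  moreover have "(\<alpha> - \<beta>) *\<^sub>R rot x \<in> CSO2"
    using ab by (intro scaleR_rot_in_CSO2) simp
  ultimately show ?thesis using rot_in_CSO2 that by blast
qed

text \<open>Exchanging the coordinate axes by a quarter turn and rescaling inverts the stretch factor.\<close>

lemma stretch_inverse_conformal:
  assumes "t > 0"
  shows "stretch (1 / t) = ((1 / t) *\<^sub>R rot (pi / 2)) ** stretch t ** rot (- (pi / 2))"
  using assms by (simp add: mat2)

definition conformal_sup :: "(real^2^2 \<Rightarrow> real) \<Rightarrow> real \<Rightarrow> real" where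
  "conformal_sup w t = (SUP (A, B)\<in>CSO2 \<times> CSO2. w (A ** stretch t ** B))"

text \<open>Changing one entry of \<open>stretch\<close> moves along a rank-one line.\<close>

lemma conformal_line_convex:
  assumes w: "rank_one_convex w" and A: "A \<in> CSO2" and B: "B \<in> CSO2"
    and r: "0 \<le> r" "r \<le> 1" and st: "s > 0" "t > 0"
  shows "w (A ** stretch ((1 - r) * s + r * t) ** B)
    \<le> (1 - r) * w (A ** stretch s ** B) + r * w (A ** stretch t ** B)"
proof (cases "s = t")
  case True
  then show ?thesis by (simp add: algebra_simps)
next
  case False
  let ?F = "\<lambda>s. A ** stretch s ** B"
  define H where "H = ?F t - ?F s"
  have H: "H = A ** (stretch t - stretch s) ** B"
    by (simp add: H_def mat2 algebra_simps)
  have nz: "det A \<noteq> 0" "det B \<noteq> 0" using A B CSO2_subset_GLp by (force simp: GLp_def)+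
  have "det H = 0"
    unfolding H by (simp add: det_mul) (simp add: det_2)
  moreover have "H \<noteq> 0"
  proof
    assume "H = 0"
    have "invertible A" "invertible B" using nz by (simp_all add: invertible_det_nz)
    then obtain A' B' where inv: "A' ** A = mat 1" "B ** B' = mat 1"
      unfolding invertible_def by blast
    have "stretch t - stretch s = (A' ** A) ** (stretch t - stretch s) ** (B ** B')"
      by (simp add: inv)
    also have "\<dots> = A' ** H ** B'"
      by (simp add: H matrix_mul_assoc)
    also have "\<dots> = 0"
      using \<open>H = 0\<close> by (simp add: mat2)
    finally have "(stretch t - stretch s) $ 1 $ 1 = 0" by simp
    then show False using False by simp
  qed
  ultimately have "rank H = 1" using rank_one_iff_2x2 by blast
  moreover have "?F s \<in> GLp" "?F s + H \<in> GLp"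
    using conformal_stretch_in_GLp st A B by (simp_all add: H_def)
  ultimately have "w ((1 - r) *\<^sub>R ?F s + r *\<^sub>R (?F s + H)) \<le> (1 - r) * w (?F s) + r * w (?F s + H)"
    using w r unfolding rank_one_convex_def by auto
  moreover have "(1 - r) *\<^sub>R ?F s + r *\<^sub>R ?F t = ?F ((1 - r) * s + r * t)"
    by (simp add: mat2 algebra_simps)
  ultimately show ?thesis by (simp add: H_def)
qed

text \<open>Convexity passes to suprema, and the bound by \<open>W\<close> is its conformal invariance. Monotonicity comes from
  the symmetry under \<open>t \<mapsto> 1/t\<close>: for \<open>1 \<le> s \<le> t\<close> the point \<open>s\<close> lies between \<open>1/t\<close> and \<open>t\<close>, at both of which a
  bound by the value at \<open>t\<close> holds.\<close>

lemma conformal_sup_minorant: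
  assumes w: "rank_one_convex w" and le: "\<forall>X\<in>GLp. w X \<le> W X"
    and W: "conformally_invariant W"
  shows "mono_on {1..} (conformal_sup w)" "convex_on {1..} (conformal_sup w)"
    and "\<And>t. t > 0 \<Longrightarrow> conformal_sup w t \<le> W (stretch t)"
    and "\<And>A t B. t > 0 \<Longrightarrow> A \<in> CSO2 \<Longrightarrow> B \<in> CSO2 \<Longrightarrow> w (A ** stretch t ** B) \<le> conformal_sup w t"
proof -
  have bound: "w (A ** stretch t ** B) \<le> W (stretch t)" if "t > 0" "A \<in> CSO2" "B \<in> CSO2" for A t B
    using bspec[OF le conformal_stretch_in_GLp[OF that]] W stretch_in_GLp[OF that(1)] that
    unfolding conformally_invariant_def by simp
  have upper: "w (A ** stretch t ** B) \<le> conformal_sup w t" if "t > 0" "A \<in> CSO2" "B \<in> CSO2" for A t B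
    unfolding conformal_sup_def
    by (rule cSUP_upper2[where x = "(A, B)"]) (use bound that in \<open>auto intro!: bdd_aboveI2[of _ _ "W (stretch t)"]\<close>)
  have least: "conformal_sup w t \<le> c"
    if "\<And>A B. A \<in> CSO2 \<Longrightarrow> B \<in> CSO2 \<Longrightarrow> w (A ** stretch t ** B) \<le> c" for t c
    unfolding conformal_sup_def using that mat_1_in_CSO2 by (intro cSUP_least) auto
  show "\<And>t. t > 0 \<Longrightarrow> conformal_sup w t \<le> W (stretch t)"
    "\<And>A t B. t > 0 \<Longrightarrow> A \<in> CSO2 \<Longrightarrow> B \<in> CSO2 \<Longrightarrow> w (A ** stretch t ** B) \<le> conformal_sup w t"
    using bound upper least by blast+
  have conv: "conformal_sup w ((1 - r) * s + r * t)
      \<le> (1 - r) * conformal_sup w s + r * conformal_sup w t"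
    if r: "0 \<le> r" "r \<le> 1" and st: "s > 0" "t > 0" for r s t
  proof (rule least)
    fix A B :: "real^2^2" assume AB: "A \<in> CSO2" "B \<in> CSO2"
    have "w (A ** stretch ((1 - r) * s + r * t) ** B)
        \<le> (1 - r) * w (A ** stretch s ** B) + r * w (A ** stretch t ** B)"
      by (rule conformal_line_convex[OF w AB r st])
    also have "\<dots> \<le> (1 - r) * conformal_sup w s + r * conformal_sup w t"
      using r upper AB st by (intro add_mono mult_left_mono) auto
    finally show "w (A ** stretch ((1 - r) * s + r * t) ** B)
        \<le> (1 - r) * conformal_sup w s + r * conformal_sup w t" .
  qed
  show "convex_on {1..} (conformal_sup w)"
    using conv by (intro convex_onI) auto
  have inv: "conformal_sup w (1 / t) \<le> conformal_sup w t" if "t > 0" for t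
  proof (rule least)
    fix A B :: "real^2^2" assume AB: "A \<in> CSO2" "B \<in> CSO2"
    have "A ** stretch (1 / t) ** B
        = (A ** ((1 / t) *\<^sub>R rot (pi / 2))) ** stretch t ** (rot (- (pi / 2)) ** B)"
      unfolding stretch_inverse_conformal[OF that] by (simp add: matrix_mul_assoc)
    also have "w \<dots> \<le> conformal_sup w t"
      using AB that by (intro upper CSO2_mult scaleR_rot_in_CSO2 rot_in_CSO2) auto
    finally show "w (A ** stretch (1 / t) ** B) \<le> conformal_sup w t" .
  qed
  show "mono_on {1..} (conformal_sup w)"
  proof (rule mono_onI)
    fix s t :: real assume "s \<in> {1..}" "t \<in> {1..}" "s \<le> t"
    then have st: "1 \<le> s" "s \<le> t" "0 < t" by auto
    show "conformal_sup w s \<le> conformal_sup w t"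
    proof (cases "t = 1")
      case True
      with st show ?thesis by simp
    next
      case False
      then have "1 / t < 1" "1 < t" using st by simp_all
      define r where "r = (s - 1 / t) / (t - 1 / t)"
      have pos: "t - 1 / t > 0" using \<open>1 / t < 1\<close> \<open>1 < t\<close> by linarith
      have r: "0 \<le> r" "r \<le> 1"
      proof -
        show "0 \<le> r"
          unfolding r_def using pos st \<open>1 / t < 1\<close> by (intro divide_nonneg_pos) linarith+
        show "r \<le> 1"
          unfolding r_def pos_divide_le_eq[OF pos] using st by simp
      qed
      have "(1 - r) * (1 / t) + r * t = 1 / t + r * (t - 1 / t)"
        by (simp add: left_diff_distrib right_diff_distrib diff_divide_distrib)
      also have "\<dots> = s" using pos by (simp add: r_def)
      finally have "conformal_sup w s \<le> (1 - r) * conformal_sup w (1 / t) + r * conformal_sup w t"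
        using conv[OF r, of "1 / t" t] st by simp
      also have "\<dots> \<le> (1 - r) * conformal_sup w t + r * conformal_sup w t"
        using r inv st by (intro add_mono mult_left_mono) auto
      finally show ?thesis by (simp add: algebra_simps)
    qed
  qed
qed

text \<open>One argument serves all three envelopes: the class \<open>C\<close> only has to lie between the functions \<open>p \<circ> distortion\<close>
  and the rank-one convex functions.\<close>

lemma envelope_eq_Cm:
  assumes inv: "conformally_invariant W" and bdd: "bdd_below (W ` GLp)"
    and W: "\<And>F. F \<in> GLp \<Longrightarrow> W F = h (distortion F)"
    and C_rank_one: "\<And>w. C w \<Longrightarrow> rank_one_convex w"
    and C_distortion: "\<And>p. mono_on {1..} p \<Longrightarrow> convex_on {1..} p \<Longrightarrow> C (\<lambda>F. p (distortion F))"
    and F: "F \<in> GLp"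
  shows "envelope C W F = Cm h (distortion F)"
proof -
  obtain b where b: "\<And>X. X \<in> GLp \<Longrightarrow> b \<le> W X"
    using bdd by (auto simp: bdd_below_def)
  have W_stretch: "W (stretch s) = h s" if "s \<ge> 1" for s
    using W[OF stretch_in_GLp, of s] distortion_stretch[OF that] that by simp
  have b_h: "b \<le> h s" if "s \<ge> 1" for s
    using b[OF stretch_in_GLp, of s] W_stretch[OF that] that by simp
  have const: "mono_on {1..} (\<lambda>_. b)" "convex_on {1..} (\<lambda>_::real. b)"
    by (auto simp: convex_on_const mono_on_def)
  note F1 = distortion_ge_1[OF F]
  let ?E = "{w F | w. C w \<and> (\<forall>X\<in>GLp. w X \<le> W X)}"
  let ?P = "{p (distortion F) | p. mono_on {1..} p \<and> convex_on {1..} p \<and> (\<forall>s\<ge>1. p s \<le> h s)}"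
  have E: "p (distortion F) \<in> ?E" if "mono_on {1..} p" "convex_on {1..} p" "\<forall>s\<ge>1. p s \<le> h s" for p
    using C_distortion[OF that(1,2)] that(3) W distortion_ge_1 by fastforce
  have "b \<in> ?E" "b \<in> ?P"
    using E[OF const] const b_h by auto
  show ?thesis
    unfolding envelope_def Cm_def
  proof (rule antisym)
    show "Sup ?E \<le> Sup ?P"
    proof (rule cSup_least)
      show "?E \<noteq> {}" using \<open>b \<in> ?E\<close> by blast
      fix y assume "y \<in> ?E"
      then obtain w where w: "y = w F" "C w" "\<forall>X\<in>GLp. w X \<le> W X" by blast
      note sup = conformal_sup_minorant[OF C_rank_one[OF w(2)] w(3) inv]
      have "conformal_sup w s \<le> h s" if "s \<ge> 1" for s
        using sup(3)[of s] W_stretch[OF that] that by simp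
      then have "conformal_sup w (distortion F) \<in> ?P"
        using sup(1,2) by blast
      moreover have "bdd_above ?P"
        using F1 by (intro bdd_aboveI[of _ "h (distortion F)"]) auto
      ultimately have "conformal_sup w (distortion F) \<le> Sup ?P"
        by (rule cSup_upper)
      moreover obtain A B where AB: "A \<in> CSO2" "B \<in> CSO2" "F = A ** stretch (distortion F) ** B"
        using conformal_decomposition[OF F] .
      then have "w F \<le> conformal_sup w (distortion F)"
        using sup(4)[OF _ AB(1,2), of "distortion F"] F1 by simp
      ultimately show "y \<le> Sup ?P" using w(1) by simp
    qed
    show "Sup ?P \<le> Sup ?E"
    proof (rule cSup_subset_mono)
      show "?P \<noteq> {}" using \<open>b \<in> ?P\<close> by blast
      show "bdd_above ?E" using F by (intro bdd_aboveI[of _ "W F"]) auto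
      show "?P \<subseteq> ?E" using E by blast
    qed
  qed
qed

theorem theorem3p3:
  fixes W :: "real^2^2 \<Rightarrow> real" and h :: "real \<Rightarrow> real"
  assumes "conformally_invariant W"
    and "bdd_below (W ` GLp)"
    and "\<And>F l1 l2. F \<in> GLp \<Longrightarrow> ordered_singular_values F l1 l2 \<Longrightarrow> W F = h (l1 / l2)"
  shows "\<forall>F\<in>GLp. \<forall>l1 l2. ordered_singular_values F l1 l2 \<longrightarrow>
           RW W F = QW W F \<and> QW W F = PW W F \<and> PW W F = Cm h (l1 / l2)"
proof (intro ballI allI impI)
  fix F l1 l2 assume F: "F \<in> GLp" and sv: "ordered_singular_values F l1 l2"
  have W: "W X = h (distortion X)" if X: "X \<in> GLp" for X
  proof -
    have "ordered_singular_values X (cmod (conf_part X) + cmod (anti_part X))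
        (cmod (conf_part X) - cmod (anti_part X))"
      using ordered_singular_values_iff[OF X] by simp
    from assms(3)[OF X this] show ?thesis by (simp add: distortion_def)
  qed
  note env = envelope_eq_Cm[OF assms(1,2) W _ _ F]
  have poly: "polyconvex (\<lambda>F. p (distortion F))" and quasi: "quasiconvex (\<lambda>F. p (distortion F))"
    if "mono_on {1..} p" "convex_on {1..} p" for p
    using has_polyaffine_minorants_distortion[OF that] continuous_on_monotone_convex_distortion[OF that]
      polyconvex_if_minorants quasiconvex_if_minorants by blast+
  have "RW W F = Cm h (distortion F)"
    unfolding RW_def using poly rank_one_convex_if_polyconvex by (intro env) blast+
  moreover have "QW W F = Cm h (distortion F)"
    unfolding QW_def using quasi rank_one_convex_if_quasiconvex by (intro env) blast+
  moreover have "PW W F = Cm h (distortion F)"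
    unfolding PW_def using poly rank_one_convex_if_polyconvex by (intro env) blast+
  ultimately show "RW W F = QW W F \<and> QW W F = PW W F \<and> PW W F = Cm h (l1 / l2)"
    using ordered_singular_values_distortion[OF F sv] by simp
qed

end
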